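(* Let $r\neq s$ be positive integers, $n=3r+2s$ and $d=\gcd(r,s)$. The monodromy group of each of the two trees with passport $[r^3,s^2;5,1^{n-5};n]$ is isomorphic to a semidirect product $$\begin{cases}(A_{n/d})^d\rtimes\mathbb{Z}_{2d} & \text{if } n/d\text{ is even},\\ (A_{n/d})^d\rtimes\mathbb{Z}_d & \text{if } n/d \text{ is odd}.\end{cases}$$
   Context: A tree is a bicolored (black/white) plane tree, up to color- and orientation-preserving isomorphism. The passport $[\alpha;\beta;n]$ of a tree with $n$ edges records the partition $\alpha\vdash n$ of black vertex degrees and $\beta\vdash n$ of white vertex degrees ($k^m$ means $k$ repeated $m$ times). Label the edges by $1,\dots,n$; let $\sigma_0\in S_n$ (resp. $\sigma_1$) be the permutation whose cycles are the cyclic orders of edges around the black (resp. white) vertices. The monodromy group is $\langle\sigma_0,\sigma_1\rangle\le S_n$ (well defined up to conjugacy). For $r\ne s$ there are exactly two trees with this passport. $A_m$ is the alternating group and $\mathbb{Z}_m$ the cyclic group of order $m$. *)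

theory Defs
  imports
    "HOL-Algebra.Algebra"
    "HOL-Combinatorics.Orbits"
    "HOL-Library.Multiset"
begin

section \<open>Bicolored plane trees\<close>

text \<open>
  A tree has no multiple edges, so an edge is the pair of its black and its white end. Up to
  orientation-preserving homeomorphism, a plane embedding of a tree is the same thing as a cyclic
  order on the edges at each vertex. Each edge has exactly one black end, so the cyclic orders
  around all the black vertices together form one ``next edge'' permutation of the set of edges;
  likewise for the white vertices.
\<close>

record ('b, 'w) bicolored_map =
  blacks :: "'b set"
  whites :: "'w set"
  edges :: "('b \<times> 'w) set"
  rot_black :: "'b \<times> 'w \<Rightarrow> 'b \<times> 'w"
  rot_white :: "'b \<times> 'w \<Rightarrow> 'b \<times> 'w"

definition black_star :: "('b, 'w) bicolored_map \<Rightarrow> 'b \<Rightarrow> ('b \<times> 'w) set" where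
  "black_star T b = {e \<in> edges T. fst e = b}"

definition white_star :: "('b, 'w) bicolored_map \<Rightarrow> 'w \<Rightarrow> ('b \<times> 'w) set" where
  "white_star T w = {e \<in> edges T. snd e = w}"

definition vertices :: "('b, 'w) bicolored_map \<Rightarrow> ('b + 'w) set" where
  "vertices T = Inl ` blacks T \<union> Inr ` whites T"

definition adjacency :: "('b, 'w) bicolored_map \<Rightarrow> ('b + 'w) rel" where
  "adjacency T = (\<Union>(b, w) \<in> edges T. {(Inl b, Inr w), (Inr w, Inl b)})"

definition connected_map :: "('b, 'w) bicolored_map \<Rightarrow> bool" where
  "connected_map T \<longleftrightarrow>
     vertices T \<noteq> {} \<and> (\<forall>u \<in> vertices T. \<forall>v \<in> vertices T. (u, v) \<in> (adjacency T)\<^sup>*)"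

definition is_cycle :: "('b, 'w) bicolored_map \<Rightarrow> ('b + 'w) list \<Rightarrow> bool" where
  "is_cycle T p \<longleftrightarrow>
     3 \<le> length p \<and> distinct p \<and>
     (\<forall>i. Suc i < length p \<longrightarrow> (p ! i, p ! Suc i) \<in> adjacency T) \<and>
     (last p, hd p) \<in> adjacency T"

text \<open>
  The conditions on the rotations say that each is a permutation of the edges which permutes the
  edges at every vertex in a single cycle. They range over edges rather than vertices because
  \<^const>\<open>cyclic_on\<close> fails on the empty star of the vertex of the one-vertex tree.
\<close>

definition bicolored_plane_tree :: "('b, 'w) bicolored_map \<Rightarrow> bool" where
  "bicolored_plane_tree T \<longleftrightarrow>
     finite (blacks T) \<and> finite (whites T) \<and> edges T \<subseteq> blacks T \<times> whites T \<and>
     connected_map T \<and> (\<nexists>p. is_cycle T p) \<and>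
     rot_black T permutes edges T \<and>
     (\<forall>e \<in> edges T. cyclic_on (rot_black T) (black_star T (fst e))) \<and>
     rot_white T permutes edges T \<and>
     (\<forall>e \<in> edges T. cyclic_on (rot_white T) (white_star T (snd e)))"

definition passport :: "('b, 'w) bicolored_map \<Rightarrow> nat multiset \<times> nat multiset \<times> nat" where
  "passport T =
     (image_mset (\<lambda>b. card (black_star T b)) (mset_set (blacks T)),
      image_mset (\<lambda>w. card (white_star T w)) (mset_set (whites T)),
      card (edges T))"


section \<open>Monodromy group\<close>

definition edge_labelling :: "('b, 'w) bicolored_map \<Rightarrow> (nat \<Rightarrow> 'b \<times> 'w) \<Rightarrow> bool" where
  "edge_labelling T l \<longleftrightarrow> bij_betw l {1..card (edges T)} (edges T)"

text \<open>
  Transport of a permutation of the edges along a labelling, extended by the identity outside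
  \<open>{1..n}\<close> as required by \<^const>\<open>sym_group\<close>.
\<close>

definition labelled_perm ::
  "('b, 'w) bicolored_map \<Rightarrow> (nat \<Rightarrow> 'b \<times> 'w) \<Rightarrow> ('b \<times> 'w \<Rightarrow> 'b \<times> 'w) \<Rightarrow> nat \<Rightarrow> nat" where
  "labelled_perm T l \<rho> =
     (let I = {1..card (edges T)} in perm_restrict (inv_into I l \<circ> \<rho> \<circ> l) I)"

definition monodromy_group ::
  "('b, 'w) bicolored_map \<Rightarrow> (nat \<Rightarrow> 'b \<times> 'w) \<Rightarrow> (nat \<Rightarrow> nat) monoid" where
  "monodromy_group T l =
     subgroup_generated (sym_group (card (edges T)))
       {labelled_perm T l (rot_black T), labelled_perm T l (rot_white T)}"


section \<open>Semidirect products\<close>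

text \<open>
  The outer semidirect product \<open>N \<rtimes> H\<close> for an action \<open>\<phi> \<in> hom H (AutoGroup N)\<close>.
\<close>

definition semidirect_product ::
  "('a, 'm) monoid_scheme \<Rightarrow> ('c, 'k) monoid_scheme \<Rightarrow> ('c \<Rightarrow> 'a \<Rightarrow> 'a) \<Rightarrow> ('a \<times> 'c) monoid" where
  "semidirect_product N H \<phi> =
     \<lparr>carrier = carrier N \<times> carrier H,
      monoid.mult = (\<lambda>(a, h) (b, k). (a \<otimes>\<^bsub>N\<^esub> \<phi> h b, h \<otimes>\<^bsub>H\<^esub> k)),
      one = (\<one>\<^bsub>N\<^esub>, \<one>\<^bsub>H\<^esub>)\<rparr>"

definition iso_to_semidirect_product ::
  "('g, 'l) monoid_scheme \<Rightarrow> ('a, 'm) monoid_scheme \<Rightarrow> ('c, 'k) monoid_scheme \<Rightarrow> bool" where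
  "iso_to_semidirect_product G N H \<longleftrightarrow>
     (\<exists>\<phi> \<in> hom H (AutoGroup N). G \<cong> semidirect_product N H \<phi>)"

abbreviation alt_group_power :: "nat \<Rightarrow> nat \<Rightarrow> (nat \<Rightarrow> nat \<Rightarrow> nat) monoid" where
  "alt_group_power m d \<equiv> product_group {..<d} (\<lambda>_. alt_group m)"

end

(*
  Let r and s be the periods of the black rotation a on the edges at the white vertex of degree 5, and
  let b be the 5-cycle of these edges. Every edge is a^k x for an edge x at this vertex, and k mod d
  is well defined; the d classes of edges are blocks, permuted cyclically by a and fixed by b. For
  k = r or k = s the conjugate of b by a^k shares exactly three or exactly two points with b, and
  suitable words in the two 5-cycles are 3-cycles. Lying on a common 3-cycle of the group is an
  invariant equivalence relation; its class of the five edges is stable under a^r and a^s, hence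
  under a^d, so it contains a whole block, and the group contains the alternating group of each block.
  These generate a normal subgroup with cyclic quotient generated by a. Correcting a by an even
  permutation of one block makes its d-th power trivial or, when a^d is odd on the blocks, an
  involution, which yields a cyclic complement of order d or 2d.
*)

theory Submission
  imports Defs
begin

text \<open>The parity of n/d enters through a sign: the cycles of \<open>a^d\<close> on a block
  correspond to the five edges at the vertex of degree 5, so on n/d points \<open>a^d\<close> is odd
  exactly when n/d is even. The powers of \<open>a\<close> give no complement in general, because
  \<open>a\<close> has order lcm(r, s), which can exceed d and 2d. A correction by an even
  permutation cannot change the sign of \<open>a^d\<close>, so for n/d even the d-th power cannot be
  made trivial. One of the exponents r, s may be useless: if s divides r, then \<open>a^r\<close>
  fixes all five edges and conjugation by it returns \<open>b\<close>. As r differs from s, this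
  cannot happen for both, but the number of common points, three or two, depends on which one works.
  Together with the two cyclic arrangements rrrss and rrsrs of the periods, one for each tree, this
  makes four configurations, each with its own word. The 3-cycle so found links only some of the
  five edges; that 5 is prime spreads the link to all of them.\<close>

section \<open>Internal semidirect products\<close>

text \<open>Conjugation by \<open>\<chi> c\<close>, pulled back along the injective
  \<open>\<psi>\<close>, is the action. The premise \<open>disj\<close> does double duty: it makes
  \<open>\<chi>\<close> injective and the two images meet trivially.\<close>

lemma iso_to_semidirect_productI:
  assumes G: "group G" and N: "group N" and C: "group C"
    and \<psi>: "\<psi> \<in> hom N G" and \<psi>_inj: "inj_on \<psi> (carrier N)" and \<chi>: "\<chi> \<in> hom C G"
    and normal: "\<And>c x. c \<in> carrier C \<Longrightarrow> x \<in> carrier N \<Longrightarrow>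
                   \<chi> c \<otimes>\<^bsub>G\<^esub> \<psi> x \<otimes>\<^bsub>G\<^esub> inv\<^bsub>G\<^esub> \<chi> c \<in> \<psi> ` carrier N"
    and disj: "\<And>c. c \<in> carrier C \<Longrightarrow> \<chi> c \<in> \<psi> ` carrier N \<Longrightarrow> c = \<one>\<^bsub>C\<^esub>"
    and gen: "\<And>g. g \<in> carrier G \<Longrightarrow> \<exists>x\<in>carrier N. \<exists>c\<in>carrier C. g = \<psi> x \<otimes>\<^bsub>G\<^esub> \<chi> c"
  shows "iso_to_semidirect_product G N C"
proof -
  interpret G: group G by fact
  interpret N: group N by fact
  interpret C: group C by fact
  interpret \<psi>: group_hom N G \<psi> using \<psi> by unfold_locales
  interpret \<chi>: group_hom C G \<chi> using \<chi> by unfold_locales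
  \<comment> \<open>\<open>AutoGroup\<close> consists of extensional bijections, hence the
    restriction to \<open>carrier N\<close>.\<close>
  define \<phi> where "\<phi> c = (\<lambda>x\<in>carrier N. inv_into (carrier N) \<psi> (\<chi> c \<otimes>\<^bsub>G\<^esub> \<psi> x \<otimes>\<^bsub>G\<^esub> inv\<^bsub>G\<^esub> \<chi> c))" for c
  have \<phi>_closed: "\<phi> c x \<in> carrier N" and \<psi>_\<phi>: "\<psi> (\<phi> c x) = \<chi> c \<otimes>\<^bsub>G\<^esub> \<psi> x \<otimes>\<^bsub>G\<^esub> inv\<^bsub>G\<^esub> \<chi> c"
    if "c \<in> carrier C" "x \<in> carrier N" for c x
    using normal[OF that] that(2) by (auto simp: \<phi>_def inv_into_into f_inv_into_f)
  have \<psi>_eq: "x = y" if "\<psi> x = \<psi> y" "x \<in> carrier N" "y \<in> carrier N" for x y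
    using \<psi>_inj that by (auto dest: inj_onD)
  have cancel: "inv\<^bsub>G\<^esub> g \<otimes>\<^bsub>G\<^esub> (g \<otimes>\<^bsub>G\<^esub> h) = h" if "g \<in> carrier G" "h \<in> carrier G" for g h
    using that by (simp flip: G.m_assoc)
  have \<phi>_mult: "\<phi> c (x \<otimes>\<^bsub>N\<^esub> y) = \<phi> c x \<otimes>\<^bsub>N\<^esub> \<phi> c y"
    if "c \<in> carrier C" "x \<in> carrier N" "y \<in> carrier N" for c x y
    by (rule \<psi>_eq) (use that in \<open>simp_all add: \<phi>_closed \<psi>_\<phi> G.m_assoc cancel\<close>)
  have \<phi>_comp: "\<phi> (c \<otimes>\<^bsub>C\<^esub> c') x = \<phi> c (\<phi> c' x)"
    if "c \<in> carrier C" "c' \<in> carrier C" "x \<in> carrier N" for c c' x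
    by (rule \<psi>_eq) (use that in \<open>simp_all add: \<phi>_closed \<psi>_\<phi> G.m_assoc G.inv_mult_group\<close>)
  have \<phi>_one: "\<phi> \<one>\<^bsub>C\<^esub> x = x" if "x \<in> carrier N" for x
    by (rule \<psi>_eq) (use that in \<open>simp_all add: \<phi>_closed \<psi>_\<phi>\<close>)
  have \<phi>_inv: "\<phi> (inv\<^bsub>C\<^esub> c) (\<phi> c x) = x" "\<phi> c (\<phi> (inv\<^bsub>C\<^esub> c) x) = x"
    if "c \<in> carrier C" "x \<in> carrier N" for c x
    using that by (simp_all add: \<phi>_one flip: \<phi>_comp)
  have \<phi>_bij: "\<phi> c \<in> Bij (carrier N)" if "c \<in> carrier C" for c
    unfolding Bij_def
  proof (intro IntI CollectI bij_betwI[where g = "\<phi> (inv\<^bsub>C\<^esub> c)"])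
    show "\<phi> c \<in> extensional (carrier N)" by (simp add: \<phi>_def)
  qed (use that in \<open>simp_all add: \<phi>_closed \<phi>_inv\<close>)
  have \<phi>_auto: "\<phi> c \<in> auto N" if "c \<in> carrier C" for c
    using that \<phi>_bij by (auto simp: auto_def hom_def \<phi>_closed \<phi>_mult)
  have "\<phi> \<in> hom C (AutoGroup N)"
  proof (rule homI)
    fix c c' assume c: "c \<in> carrier C" "c' \<in> carrier C"
    have "\<phi> (c \<otimes>\<^bsub>C\<^esub> c') = compose (carrier N) (\<phi> c) (\<phi> c')"
    proof (rule extensionalityI[where A = "carrier N"])
      show "\<phi> (c \<otimes>\<^bsub>C\<^esub> c') \<in> extensional (carrier N)" by (simp add: \<phi>_def)
    qed (use c in \<open>simp_all add: compose_def \<phi>_comp\<close>)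
    then show "\<phi> (c \<otimes>\<^bsub>C\<^esub> c') = \<phi> c \<otimes>\<^bsub>AutoGroup N\<^esub> \<phi> c'"
      using c \<phi>_bij by (simp add: AutoGroup_def BijGroup_def)
  qed (simp add: AutoGroup_def \<phi>_auto)
  let ?P = "semidirect_product N C \<phi>"
  define f where "f = (\<lambda>(x, c). \<psi> x \<otimes>\<^bsub>G\<^esub> \<chi> c)"
  have f_mult: "f (u \<otimes>\<^bsub>?P\<^esub> v) = f u \<otimes>\<^bsub>G\<^esub> f v" and P_closed: "u \<otimes>\<^bsub>?P\<^esub> v \<in> carrier ?P"
    if "u \<in> carrier ?P" "v \<in> carrier ?P" for u v
    using that
    by (auto simp: semidirect_product_def f_def \<phi>_closed \<psi>_\<phi> G.m_assoc cancel)
  have "inj_on f (carrier ?P)"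
  proof (rule inj_onI)
    fix u v assume uv: "u \<in> carrier ?P" "v \<in> carrier ?P" "f u = f v"
    obtain x c y c' where [simp]: "u = (x, c)" "v = (y, c')" by (cases u, cases v)
    have car: "x \<in> carrier N" "y \<in> carrier N" "c \<in> carrier C" "c' \<in> carrier C"
      using uv by (auto simp: semidirect_product_def)
    have eq: "\<psi> x \<otimes>\<^bsub>G\<^esub> \<chi> c = \<psi> y \<otimes>\<^bsub>G\<^esub> \<chi> c'" using uv by (simp add: f_def)
    \<comment> \<open>If two products agree, the quotient of their \<open>C\<close>-parts lies in
      the image of \<open>N\<close>, where \<open>disj\<close> applies.\<close>
    have "\<chi> (c \<otimes>\<^bsub>C\<^esub> inv\<^bsub>C\<^esub> c') = inv\<^bsub>G\<^esub> \<psi> x \<otimes>\<^bsub>G\<^esub> (\<psi> x \<otimes>\<^bsub>G\<^esub> \<chi> c) \<otimes>\<^bsub>G\<^esub> inv\<^bsub>G\<^esub> \<chi> c'"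
      using car by (simp add: G.m_assoc[symmetric])
    also have "\<dots> = \<psi> (inv\<^bsub>N\<^esub> x \<otimes>\<^bsub>N\<^esub> y)"
      using car by (simp add: eq G.m_assoc)
    finally have "\<chi> (c \<otimes>\<^bsub>C\<^esub> inv\<^bsub>C\<^esub> c') \<in> \<psi> ` carrier N"
      by (rule image_eqI) (use car in simp)
    then have "c \<otimes>\<^bsub>C\<^esub> inv\<^bsub>C\<^esub> c' = \<one>\<^bsub>C\<^esub>" using disj car by simp
    then have "c = c'" using car by (metis C.inv_equality C.inv_closed C.inv_inv)
    then show "u = v" using eq car by (auto intro: \<psi>_eq)
  qed
  moreover have "f ` carrier ?P = carrier G"
    using gen by (force simp: semidirect_product_def f_def)
  ultimately have f_bij: "bij_betw f (carrier ?P) (carrier G)" by (simp add: bij_betw_def)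
  define g where "g = inv_into (carrier ?P) f"
  have g: "g x \<in> carrier ?P" "f (g x) = x" if "x \<in> carrier G" for x
    using f_bij that by (auto simp: g_def bij_betw_def inv_into_into f_inv_into_f)
  have "g (x \<otimes>\<^bsub>G\<^esub> y) = g x \<otimes>\<^bsub>?P\<^esub> g y" if "x \<in> carrier G" "y \<in> carrier G" for x y
  proof (rule inj_onD[OF bij_betw_imp_inj_on[OF f_bij]])
    show "f (g (x \<otimes>\<^bsub>G\<^esub> y)) = f (g x \<otimes>\<^bsub>?P\<^esub> g y)" using that by (simp add: g f_mult)
  qed (use that g P_closed in auto)
  then have "g \<in> iso G ?P"
    using g bij_betw_inv_into[OF f_bij] by (auto simp: iso_def hom_def g_def)
  then show ?thesis
    using \<open>\<phi> \<in> hom C (AutoGroup N)\<close> unfolding iso_to_semidirect_product_def by (auto simp: is_iso_def)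
qed

section \<open>Cycle type and sign\<close>

lemma orbit_eq_set_support: "permutation f \<Longrightarrow> orbit f x = set (support f x)"
  by (subst support_set) (auto simp: orbit_altdef_permutation)

lemma card_cyclic_on:
  assumes "permutation f" "cyclic_on f A" "x \<in> A"
  shows "card A = least_power f x"
  using distinct_card[OF cycle_of_permutation[OF assms(1)], of x]
    orbit_eq_set_support[OF assms(1), of x] orbit_cyclic_eq3[OF assms(2,3)]
  by (metis diff_zero length_map length_upt)

lemma evenperm_cycle_of_list:
  "distinct cs \<Longrightarrow> cs \<noteq> [] \<Longrightarrow> evenperm (cycle_of_list cs) \<longleftrightarrow> odd (length cs)"
proof (induction cs rule: cycle_of_list.induct)
  case (1 i j cs)
  then show ?case
    by (simp add: evenperm_comp permutation_swap_id permutation_of_cycle evenperm_swap del: cycle_of_list.simps(1))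
       (simp add: evenperm_comp permutation_swap_id permutation_of_cycle evenperm_swap)
qed auto

text \<open>A cycle of length k has sign (-1)^(k-1), so the sign of \<open>t\<close> depends on the
  number of points minus the number of cycles; \<open>P\<close> picks one point of each cycle, fixed
  points included. Only parity counts, so the sum can replace the difference. The induction splits
  off one cycle at a time.\<close>

lemma evenperm_iff_even_card_transversal:
  assumes "finite P" "finite B" "t permutes B" "P \<subseteq> B"
    and "\<And>y. y \<in> B \<Longrightarrow> \<exists>x\<in>P. y \<in> orbit t x"
    and "\<And>x y. x \<in> P \<Longrightarrow> y \<in> P \<Longrightarrow> y \<in> orbit t x \<Longrightarrow> x = y"
  shows "evenperm t \<longleftrightarrow> even (card B + card P)"
  using assms
proof (induction P arbitrary: B t rule: finite_induct)
  case empty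
  then have "B = {}" by blast
  then show ?case using empty by simp
next
  case (insert x P)
  have perm: "permutation t" using insert.prems by (auto simp: permutation_permutes)
  define C where "C = orbit t x"
  have cyc: "cyclic_on t C" unfolding C_def using insert.prems by (intro cyclic_on_orbit) auto
  have C: "C = set (support t x)" unfolding C_def by (rule orbit_eq_set_support[OF perm])
  have xC: "x \<in> C" unfolding C_def by (rule permutation_self_in_orbit[OF perm])
  have CB: "C \<subseteq> B" unfolding C_def using insert.prems by (intro permutes_orbit_subset) auto
  have fC: "finite C" using C by simp
  \<comment> \<open>\<open>t'\<close> is \<open>t\<close> without the cycle of \<open>x\<close>. Its
    orbits off \<open>C\<close> are unchanged, so the remaining representatives are a transversal
    for it.\<close>
  define t' where "t' = perm_restrict t (B - C)"
  have t'_permutes: "t' permutes (B - C)"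
    unfolding t'_def by (rule perm_restrict_diff_cyclic[OF insert.prems(2) cyc])
  then have perm': "permutation t'" using insert.prems by (auto simp: permutation_permutes)
  have stays: "t y \<in> B - C" if "y \<in> B - C" for y
    using permutes_in_image[OF t'_permutes, of y] that by (simp add: t'_def perm_restrict_def)
  have t_eq: "t = cycle_of_list (support t x) \<circ> t'"
  proof
    fix y
    consider "y \<in> C" | "y \<in> B - C" | "y \<notin> B" by blast
    then show "t y = (cycle_of_list (support t x) \<circ> t') y"
    proof cases
      case 1
      then show ?thesis using cycle_restrict[OF perm] C by (simp add: t'_def perm_restrict_def)
    next
      case 2
      then show ?thesis using stays[of y] C id_outside_supp[of "t y" "support t x"]
        by (simp add: t'_def perm_restrict_def)
    next
      case 3
      then have "y \<notin> set (support t x)" using CB C by blast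
      then show ?thesis using 3 id_outside_supp[of y "support t x"] permutes_not_in[OF insert.prems(2)]
        by (simp only: o_apply t'_def perm_restrict_def) simp
    qed
  qed
  have orb': "orbit t' y = orbit t y" if "y \<in> B - C" for y
  proof (rule orbit_cong0[where A = "B - C", symmetric])
    show "t \<in> B - C \<rightarrow> B - C"
      using stays by blast
  qed (use that in \<open>auto simp: t'_def perm_restrict_def\<close>)
  have sub: "P \<subseteq> B - C"
    using insert.prems(3) insert.prems(5)[of x] insert.hyps(2) by (auto simp: C_def)
  have "evenperm t' \<longleftrightarrow> even (card (B - C) + card P)"
  proof (rule insert.IH)
    show "\<exists>z\<in>P. y \<in> orbit t' z" if y: "y \<in> B - C" for y
    proof -
      obtain z where "z \<in> insert x P" "y \<in> orbit t z" using y insert.prems(4)[of y] by auto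
      then show ?thesis using y sub orb'[of z] by (auto simp: C_def)
    qed
    show "z = y" if "z \<in> P" "y \<in> P" "y \<in> orbit t' z" for z y
      using that sub orb'[of z] insert.prems(5)[of z y] by auto
  qed (use insert.prems t'_permutes sub in auto)
  moreover have "support t x \<noteq> []"
    using xC C by auto
  then have "evenperm (cycle_of_list (support t x)) \<longleftrightarrow> odd (card C)"
    using evenperm_cycle_of_list[OF cycle_of_permutation[OF perm, of x]]
      distinct_card[OF cycle_of_permutation[OF perm, of x]] C by metis
  moreover have "card B = card (B - C) + card C"
    using CB fC insert.prems(1) by (metis card_Diff_subset card_mono le_add_diff_inverse2)
  moreover have "evenperm t \<longleftrightarrow> (evenperm (cycle_of_list (support t x)) \<longleftrightarrow> evenperm t')"
    by (subst t_eq) (rule evenperm_comp[OF permutation_of_cycle perm'])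
  ultimately show ?case using insert.hyps by auto
qed

section \<open>Three-cycles in permutation groups\<close>

lemma cycle_of_list_3_rotate:
  assumes "distinct [x, y, z]"
  shows "cycle_of_list [y, z, x] = cycle_of_list [x, y, z]"
  using assms by (auto simp: transpose_def fun_eq_iff)

lemma inv_cycle_of_list_3:
  assumes "distinct [x, y, z]"
  shows "inv' (cycle_of_list [x, y, z]) = cycle_of_list [y, x, z]"
  by (rule inv_unique_comp) (use assms in \<open>auto simp: transpose_def fun_eq_iff\<close>)

locale permutation_group =
  fixes H :: "('a \<Rightarrow> 'a) set" and S :: "'a set"
  assumes finite_S: "finite S"
    and permutes: "g \<in> H \<Longrightarrow> g permutes S"
    and id_closed: "id \<in> H"
    and comp_closed: "g \<in> H \<Longrightarrow> h \<in> H \<Longrightarrow> g \<circ> h \<in> H"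
    and inv_closed: "g \<in> H \<Longrightarrow> inv' g \<in> H"
begin

lemma funpow_closed: "g \<in> H \<Longrightarrow> g ^^ k \<in> H"
  by (induction k) (simp_all add: id_closed comp_closed)

lemma conj_closed: "g \<in> H \<Longrightarrow> h \<in> H \<Longrightarrow> g \<circ> h \<circ> inv' g \<in> H"
  by (simp add: comp_closed inv_closed)

lemma bij: "g \<in> H \<Longrightarrow> bij g"
  using permutes permutes_bij by blast

lemma cycle_3_image:
  assumes "cycle_of_list [x, y, z] \<in> H" "distinct [x, y, z]" "g \<in> H"
  shows "cycle_of_list [g x, g y, g z] \<in> H"
  using conjugation_of_cycle[OF assms(2) bij[OF assms(3)]] conj_closed[OF assms(3,1)] by simp

lemma cycle_3_reverse:
  "cycle_of_list [x, y, z] \<in> H \<Longrightarrow> distinct [x, y, z] \<Longrightarrow> cycle_of_list [y, x, z] \<in> H"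
  by (metis inv_closed inv_cycle_of_list_3)

section \<open>Lying on a common 3-cycle as an invariant equivalence relation\<close>

definition linked :: "'a \<Rightarrow> 'a \<Rightarrow> bool" where
  "linked x y \<longleftrightarrow> x = y \<or> (\<exists>z. distinct [x, y, z] \<and> cycle_of_list [x, y, z] \<in> H)"

lemma linked_refl: "linked x x"
  by (simp add: linked_def)

lemma linkedI: "distinct [x, y, z] \<Longrightarrow> cycle_of_list [x, y, z] \<in> H \<Longrightarrow> linked x y"
  unfolding linked_def by blast

lemma linkedE:
  assumes "linked x y" "x \<noteq> y"
  obtains z where "distinct [x, y, z]" "cycle_of_list [x, y, z] \<in> H"
  using assms unfolding linked_def by blast

lemma linked_sym: "linked x y \<Longrightarrow> linked y x"
  unfolding linked_def using inv_closed inv_cycle_of_list_3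
  by (metis distinct_length_2_or_more)

lemma linked_image:
  assumes "linked x y" "g \<in> H"
  shows "linked (g x) (g y)"
proof (cases "x = y")
  case False
  then obtain z where z: "distinct [x, y, z]" "cycle_of_list [x, y, z] \<in> H"
    using assms(1) by (auto elim: linkedE)
  then have "distinct [g x, g y, g z]"
    using bij[OF assms(2)] by (auto simp: bij_def inj_eq)
  then show ?thesis
    using cycle_3_image[OF z(2,1) assms(2)] by (rule linkedI)
qed (simp add: linked_refl)

lemma linked_image_iff: "g \<in> H \<Longrightarrow> linked (g x) (g y) \<longleftrightarrow> linked x y"
  using linked_image[of x y g] linked_image[of "g x" "g y" "inv' g"] inv_closed[of g] bij[of g]
  by (auto simp: bij_def inv_f_f)

text \<open>Conjugating (x y z) by a 3-cycle that fixes x and sends y to w gives a 3-cycle through x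
  and w. This is impossible only if the second 3-cycle moves x, and then it contains both x and w
  itself.\<close>

lemma linked_trans:
  assumes "linked x y" "linked y w"
  shows "linked x w"
proof (cases "x = y \<or> y = w \<or> x = w")
  case True
  then show ?thesis using assms linked_refl by auto
next
  case False
  obtain z where z: "distinct [x, y, z]" "cycle_of_list [x, y, z] \<in> H"
    using assms(1) False by (auto elim: linkedE)
  obtain u where u: "distinct [y, w, u]" "cycle_of_list [y, w, u] \<in> H"
    using assms(2) False by (auto elim: linkedE)
  show ?thesis
  proof (cases "u = x")
    case True
    then show ?thesis
      using u False linked_sym[OF linkedI, of w x y] cycle_of_list_3_rotate[of y w u] by auto
  next
    case ux: False
    let ?g = "cycle_of_list [y, w, u]"
    have "?g x = x" "?g y = w"
      using False ux u by (auto simp: transpose_def)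
    moreover have "distinct [?g x, ?g y, ?g z]"
      using z(1) bij[OF u(2)] by (auto simp: bij_def inj_eq)
    ultimately show ?thesis
      using cycle_3_image[OF z(2,1) u(2)] by (metis linkedI)
  qed
qed

text \<open>Linkage provides a 3-cycle (x y u) with some third point \<open>u\<close>. Conjugation
  by a 3-cycle that sends \<open>u\<close> to \<open>z\<close> and fixes \<open>x\<close> and
  \<open>y\<close> yields the wanted one. If that 3-cycle runs through \<open>x\<close> or
  \<open>y\<close>, its inverse is used and the orientation is repaired afterwards.\<close>

lemma linked_cycle_3:
  assumes xyz: "distinct [x, y, z]" and "linked x y" and "linked y z"
  shows "cycle_of_list [x, y, z] \<in> H"
proof -
  obtain u where u: "distinct [x, y, u]" "cycle_of_list [x, y, u] \<in> H"
    using assms by (auto elim: linkedE)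
  show ?thesis
  proof (cases "u = z")
    case True
    then show ?thesis using u by simp
  next
    case uz: False
    have "linked y u"
      using u cycle_of_list_3_rotate[of x y u] by (intro linkedI[of y u x]) auto
    then have "linked u z"
      using assms(3) linked_sym linked_trans by blast
    then obtain v where v: "distinct [u, z, v]" "cycle_of_list [u, z, v] \<in> H"
      using uz by (auto elim: linkedE)
    let ?c = "cycle_of_list [u, z, v]"
    have gen: "cycle_of_list [g x, g y, g u] \<in> H" if "g \<in> H" for g
      using cycle_3_image[OF u(2,1) that] .
    consider "v \<noteq> x" "v \<noteq> y" | "v = x" | "v = y" by blast
    then show ?thesis
    proof cases
      case 1
      then have "?c x = x" "?c y = y" "?c u = z"
        using xyz u(1) v(1) uz by (auto simp: transpose_def)
      then show ?thesis using gen[OF v(2)] by metis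
    next
      case 2
      \<comment> \<open>The cycle (u z x) would send \<open>x\<close> to \<open>u\<close>; its
        inverse removes \<open>u\<close> and brings in \<open>z\<close>, which gives the reverse of
        the wanted cycle.\<close>
      have "inv' ?c x = z" "inv' ?c y = y" "inv' ?c u = x"
        unfolding inv_cycle_of_list_3[OF v(1)]
        using xyz u(1) v(1) uz 2 by (auto simp: transpose_def)
      then have "cycle_of_list [z, y, x] \<in> H"
        using gen[OF inv_closed[OF v(2)]] by metis
      then have "cycle_of_list [y, z, x] \<in> H"
        by (rule cycle_3_reverse) (use xyz in auto)
      then show ?thesis unfolding cycle_of_list_3_rotate[OF xyz] .
    next
      case 3
      have "inv' ?c x = x" "inv' ?c y = z" "inv' ?c u = y"
        unfolding inv_cycle_of_list_3[OF v(1)]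
        using xyz u(1) v(1) uz 3 by (auto simp: transpose_def)
      then have "cycle_of_list [x, z, y] \<in> H"
        using gen[OF inv_closed[OF v(2)]] by metis
      then have "cycle_of_list [z, x, y] \<in> H"
        by (rule cycle_3_reverse) (use xyz in auto)
      moreover have "cycle_of_list [z, x, y] = cycle_of_list [y, z, x]"
        by (rule cycle_of_list_3_rotate) (use xyz in auto)
      ultimately show ?thesis using cycle_of_list_3_rotate[OF xyz] by metis
    qed
  qed
qed

text \<open>If \<open>p\<close> moves \<open>x\<close> to \<open>y\<close>, a 3-cycle (x y z) agrees
  with \<open>p\<close> at \<open>x\<close>, and dividing it off leaves an even permutation that
  fixes \<open>x\<close>. A third point \<open>z\<close> exists because the only nontrivial
  permutation of two points is odd.\<close>

lemma even_permutation_closed: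
  assumes "finite B" and "p permutes B" and "evenperm p"
    and "\<And>x y. x \<in> B \<Longrightarrow> y \<in> B \<Longrightarrow> linked x y"
  shows "p \<in> H"
  using assms
proof (induction B arbitrary: p rule: finite_induct)
  case empty
  then show ?case using id_closed by (auto simp: id_def)
next
  case (insert x B)
  show ?case
  proof (cases "p x = x")
    case True
    then have "p permutes B"
      by (intro permutes_superset[OF insert.prems(1)]) auto
    then show ?thesis
      by (rule insert.IH) (use insert.prems in auto)
  next
    case False
    define y where "y = p x"
    have y: "y \<in> insert x B" "y \<noteq> x"
      using permutes_in_image[OF insert.prems(1), of x] False by (auto simp: y_def)
    have "\<exists>z\<in>insert x B. z \<noteq> x \<and> z \<noteq> y"
    proof (rule ccontr)
      assume *: "\<not> ?thesis"
      then have "insert x B = {x, y}" using y by auto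
      then have "p permutes {x, y}" using insert.prems(1) by metis
      then have "p = id \<or> p = transpose x y" by (simp add: permutes_doubleton_iff)
      then show False
        using insert.prems(2) y False by (auto simp: evenperm_swap)
    qed
    then obtain z where z: "z \<in> insert x B" "z \<noteq> x" "z \<noteq> y" by blast
    define c where "c = cycle_of_list [x, y, z]"
    have d: "distinct [x, y, z]" using y z by auto
    have cH: "c \<in> H" unfolding c_def using d y z insert.prems(3) by (intro linked_cycle_3) auto
    have c_perm: "permutation c" unfolding c_def by (rule permutation_of_cycle)
    have c_ev: "evenperm c"
      unfolding c_def using d by (simp add: evenperm_comp evenperm_swap permutation_swap_id)
    have bc: "bij c" using cH bij by blast
    have c_permutes: "c permutes insert x B"
      unfolding c_def by (rule permutes_subset[OF cycle_permutes]) (use y z in auto)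
    let ?q = "inv' c \<circ> p"
    have "?q x = x"
      unfolding o_apply y_def[symmetric] c_def inv_cycle_of_list_3[OF d]
      using d by (auto simp: transpose_def)
    then have "?q permutes B"
      by (intro permutes_superset[OF permutes_compose[OF insert.prems(1) permutes_inv[OF c_permutes]]])
         auto
    moreover have "permutation p"
      using insert.prems(1) insert.hyps(1) by (auto simp: permutation_permutes)
    then have "evenperm ?q"
      using c_perm c_ev insert.prems(2) by (simp add: evenperm_comp evenperm_inv permutation_inverse)
    ultimately have "?q \<in> H" using insert.prems(3) by (intro insert.IH) blast+
    then have "c \<circ> ?q \<in> H" using cH comp_closed by blast
    moreover have "c \<circ> ?q = p"
      using bc by (simp add: fun_eq_iff bij_is_surj surj_f_inv_f)
    ultimately show ?thesis by simp
  qed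
qed

text \<open>
  In the next four lemmas \<open>c\<close> and \<open>e\<close> are 5-cycles with three or two common points. The words in
  \<open>c\<close> and \<open>e\<close> come from a computer search; each is a 3-cycle times two transpositions or a
  5-cycle, which the exponent kills.
\<close>

lemma linked_from_two_moved_consecutive:
  assumes "c \<in> H" "e \<in> H" and "distinct [x0, x1, x2, x3, x4, x5, x6]"
    and "c x0 = x1" "c x1 = x2" "c x2 = x3" "c x3 = x4" "c x4 = x0"
    and "\<And>y. y \<notin> {x0, x1, x2, x3, x4} \<Longrightarrow> c y = y"
    and "e x0 = x1" "e x1 = x2" "e x2 = x5" "e x5 = x6" "e x6 = x0"
    and "\<And>y. y \<notin> {x0, x1, x2, x5, x6} \<Longrightarrow> e y = y"
  shows "linked x0 x4"
proof -
  have distinct_rev: "distinct [x6, x5, x4, x3, x2, x1, x0]"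
    using assms(3) by auto
  have fixed: "c x5 = x5" "c x6 = x6" "e x3 = x3" "e x4 = x4"
    using assms(3) by (auto intro!: assms(9,15))
  have "(c \<circ> e \<circ> e) ^^ 2 = cycle_of_list [x0, x4, x3]"
  proof
    fix y
    consider "y \<in> {x0, x1, x2, x3, x4, x5, x6}" | "y \<notin> {x0, x1, x2, x3, x4, x5, x6}" by blast
    then show "((c \<circ> e \<circ> e) ^^ 2) y = cycle_of_list [x0, x4, x3] y"
    proof cases
      case 1
      then show ?thesis using assms(3) distinct_rev
        by (elim insertE emptyE) (simp_all add: numeral_eq_Suc transpose_def fixed assms(4-8,10-14))
    next
      case 2
      then have "c y = y" "e y = y" using assms(9,15) by auto
      then show ?thesis using 2 by (simp add: numeral_eq_Suc transpose_def)
    qed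
  qed
  then show ?thesis
    using assms(1-3) funpow_closed[of "c \<circ> e \<circ> e" 2] by (intro linkedI[of x0 x4 x3]) (auto simp: comp_closed)
qed

lemma linked_from_two_moved_apart:
  assumes "c \<in> H" "e \<in> H" and "distinct [x0, x1, x2, x3, x4, x5, x6]"
    and "c x0 = x1" "c x1 = x2" "c x2 = x3" "c x3 = x4" "c x4 = x0"
    and "\<And>y. y \<notin> {x0, x1, x2, x3, x4} \<Longrightarrow> c y = y"
    and "e x0 = x1" "e x1 = x5" "e x5 = x3" "e x3 = x6" "e x6 = x0"
    and "\<And>y. y \<notin> {x0, x1, x5, x3, x6} \<Longrightarrow> e y = y"
  shows "linked x0 x2"
proof -
  have distinct_rev: "distinct [x6, x5, x4, x3, x2, x1, x0]"
    using assms(3) by auto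
  have fixed: "c x5 = x5" "c x6 = x6" "e x2 = x2" "e x4 = x4"
    using assms(3) by (auto intro!: assms(9,15))
  have "(c \<circ> e \<circ> c \<circ> c) ^^ 2 = cycle_of_list [x0, x2, x3]"
  proof
    fix y
    consider "y \<in> {x0, x1, x2, x3, x4, x5, x6}" | "y \<notin> {x0, x1, x2, x3, x4, x5, x6}" by blast
    then show "((c \<circ> e \<circ> c \<circ> c) ^^ 2) y = cycle_of_list [x0, x2, x3] y"
    proof cases
      case 1
      then show ?thesis using assms(3) distinct_rev
        by (elim insertE emptyE) (simp_all add: numeral_eq_Suc transpose_def fixed assms(4-8,10-14))
    next
      case 2
      then have "c y = y" "e y = y" using assms(9,15) by auto
      then show ?thesis using 2 by (simp add: numeral_eq_Suc transpose_def)
    qed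
  qed
  then show ?thesis
    using assms(1-3) funpow_closed[of "c \<circ> e \<circ> c \<circ> c" 2]
    by (intro linkedI[of x0 x2 x3]) (auto simp: comp_closed)
qed

lemma linked_from_three_moved_consecutive:
  assumes "c \<in> H" "e \<in> H" and "distinct [x0, x1, x2, x3, x4, x5, x6, x7]"
    and "c x0 = x1" "c x1 = x2" "c x2 = x3" "c x3 = x4" "c x4 = x0"
    and "\<And>y. y \<notin> {x0, x1, x2, x3, x4} \<Longrightarrow> c y = y"
    and "e x5 = x6" "e x6 = x7" "e x7 = x3" "e x3 = x4" "e x4 = x5"
    and "\<And>y. y \<notin> {x5, x6, x7, x3, x4} \<Longrightarrow> e y = y"
  shows "linked x0 x1"
proof -
  have distinct_rev: "distinct [x7, x6, x5, x4, x3, x2, x1, x0]"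
    using assms(3) by auto
  have fixed: "c x5 = x5" "c x6 = x6" "c x7 = x7" "e x0 = x0" "e x1 = x1" "e x2 = x2"
    using assms(3) by (auto intro!: assms(9,15))
  have "(c \<circ> e \<circ> c \<circ> c) ^^ 5 = cycle_of_list [x0, x1, x3]"
  proof
    fix y
    consider "y \<in> {x0, x1, x2, x3, x4, x5, x6, x7}" | "y \<notin> {x0, x1, x2, x3, x4, x5, x6, x7}" by blast
    then show "((c \<circ> e \<circ> c \<circ> c) ^^ 5) y = cycle_of_list [x0, x1, x3] y"
    proof cases
      case 1
      then show ?thesis using assms(3) distinct_rev
        by (elim insertE emptyE) (simp_all add: numeral_eq_Suc transpose_def fixed assms(4-8,10-14))
    next
      case 2
      then have "c y = y" "e y = y" using assms(9,15) by auto
      then show ?thesis using 2 by (simp add: numeral_eq_Suc transpose_def)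
    qed
  qed
  then show ?thesis
    using assms(1-3) funpow_closed[of "c \<circ> e \<circ> c \<circ> c" 5]
    by (intro linkedI[of x0 x1 x3]) (auto simp: comp_closed)
qed

lemma linked_from_three_moved_apart:
  assumes "c \<in> H" "e \<in> H" and "distinct [x0, x1, x2, x3, x4, x5, x6, x7]"
    and "c x0 = x1" "c x1 = x2" "c x2 = x3" "c x3 = x4" "c x4 = x0"
    and "\<And>y. y \<notin> {x0, x1, x2, x3, x4} \<Longrightarrow> c y = y"
    and "e x5 = x6" "e x6 = x2" "e x2 = x7" "e x7 = x4" "e x4 = x5"
    and "\<And>y. y \<notin> {x5, x6, x2, x7, x4} \<Longrightarrow> e y = y"
  shows "linked x0 x2"
proof -
  have distinct_rev: "distinct [x7, x6, x5, x4, x3, x2, x1, x0]"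
    using assms(3) by auto
  have fixed: "c x5 = x5" "c x6 = x6" "c x7 = x7" "e x0 = x0" "e x1 = x1" "e x3 = x3"
    using assms(3) by (auto intro!: assms(9,15))
  have "(c \<circ> e \<circ> e) ^^ 5 = cycle_of_list [x0, x2, x1]"
  proof
    fix y
    consider "y \<in> {x0, x1, x2, x3, x4, x5, x6, x7}" | "y \<notin> {x0, x1, x2, x3, x4, x5, x6, x7}" by blast
    then show "((c \<circ> e \<circ> e) ^^ 5) y = cycle_of_list [x0, x2, x1] y"
    proof cases
      case 1
      then show ?thesis using assms(3) distinct_rev
        by (elim insertE emptyE) (simp_all add: numeral_eq_Suc transpose_def fixed assms(4-8,10-14))
    next
      case 2
      then have "c y = y" "e y = y" using assms(9,15) by auto
      then show ?thesis using 2 by (simp add: numeral_eq_Suc transpose_def)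
    qed
  qed
  then show ?thesis
    using assms(1-3) funpow_closed[of "c \<circ> e \<circ> e" 5]
    by (intro linkedI[of x0 x2 x1]) (auto simp: comp_closed)
qed

end

section \<open>The blocks\<close>

text \<open>The ten choices of three out of five, each listed cyclically from a suitable start: five
  rotations of the word TTTFF and five of TTFTF.\<close>

lemma three_of_five:
  assumes "of_bool A + of_bool B + of_bool C + of_bool D + of_bool E = (3::nat)"
  shows "A \<and> B \<and> C \<and> \<not> D \<and> \<not> E \<or> A \<and> B \<and> \<not> C \<and> D \<and> \<not> E \<or>
    B \<and> C \<and> D \<and> \<not> E \<and> \<not> A \<or> B \<and> C \<and> \<not> D \<and> E \<and> \<not> A \<or>
    C \<and> D \<and> E \<and> \<not> A \<and> \<not> B \<or> C \<and> D \<and> \<not> E \<and> A \<and> \<not> B \<or>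
    D \<and> E \<and> A \<and> \<not> B \<and> \<not> C \<or> D \<and> E \<and> \<not> A \<and> B \<and> \<not> C \<or>
    E \<and> A \<and> B \<and> \<not> C \<and> \<not> D \<or> E \<and> A \<and> \<not> B \<and> C \<and> \<not> D"
  using assms by (cases A; cases B; cases C; cases D; cases E) simp_all

text \<open>\<open>a\<close> and \<open>b\<close> stand for the black and the white rotation,
  \<open>P\<close> for the edges at the white vertex of degree 5. \<open>P\<close> meets each cycle
  of \<open>a\<close> once, so the two trees differ only in how the periods are arranged along
  \<open>b\<close>. Here \<open>H\<close> is any group containing both rotations; minimality comes
  with \<open>five_star_generated\<close>.\<close>

locale five_star_group = permutation_group H S
  for H :: "('a \<Rightarrow> 'a) set" and S :: "'a set" +
  fixes a b :: "'a \<Rightarrow> 'a" and P :: "'a set" and r s d :: nat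
  assumes a_closed: "a \<in> H" and b_closed: "b \<in> H"
    and P_subset: "P \<subseteq> S" and card_P: "card P = 5"
    and b_cyclic: "cyclic_on b P" and b_fixes: "y \<notin> P \<Longrightarrow> b y = y"
    and a_cover: "y \<in> S \<Longrightarrow> \<exists>x\<in>P. y \<in> orbit a x"
    and a_separate: "x \<in> P \<Longrightarrow> y \<in> P \<Longrightarrow> y \<in> orbit a x \<Longrightarrow> x = y"
    and a_period: "x \<in> P \<Longrightarrow> least_power a x = r \<or> least_power a x = s"
    and card_r: "card {x \<in> P. least_power a x = r} = 3"
    and r_neq_s: "r \<noteq> s" and r_pos: "0 < r" and s_pos: "0 < s"
    and d_def: "d = gcd r s"
    and card_S: "card S = 3 * r + 2 * s"
begin

lemma permutation_closed: "g \<in> H \<Longrightarrow> permutation g"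
  using permutes finite_S by (auto simp: permutation_permutes)

lemma finite_P: "finite P"
  using card_P by (metis card.infinite zero_neq_numeral)

lemma d_pos: "0 < d"
  using r_pos by (simp add: d_def)

lemma orbit_a: "y \<in> orbit a x \<longleftrightarrow> (\<exists>k. y = (a ^^ k) x)"
  using permutation_closed[OF a_closed] by (auto simp: orbit_altdef_permutation)

lemma bij_funpow_a: "bij (a ^^ k)"
  using funpow_closed[OF a_closed] bij by blast

lemma funpow_a_eq_self_iff: "(a ^^ k) x = x \<longleftrightarrow> least_power a x dvd k"
  using least_power_dvd[OF permutation_closed[OF a_closed]] by auto

lemma d_dvd_period: "x \<in> P \<Longrightarrow> d dvd least_power a x"
  using a_period by (auto simp: d_def)

text \<open>As \<open>P\<close> meets each cycle of \<open>a\<close> once, a power of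
  \<open>a\<close> keeps a point of \<open>P\<close> inside \<open>P\<close> only by fixing it. This
  controls how many points two conjugates of \<open>b\<close> share.\<close>

lemma funpow_a_in_P_iff: "x \<in> P \<Longrightarrow> (a ^^ k) x \<in> P \<longleftrightarrow> least_power a x dvd k"
  using a_separate orbit_a funpow_a_eq_self_iff by metis

text \<open>This makes \<open>block\<close> well defined: two ways of reaching a point from
  \<open>P\<close> start at the same point, and their exponents differ by a multiple of its period,
  hence of \<open>d\<close>.\<close>

lemma funpow_a_inject:
  assumes "x \<in> P" "y \<in> P" "(a ^^ j) x = (a ^^ k) y"
  shows "x = y \<and> j mod d = k mod d"
proof -
  have *: "u = v \<and> i mod d = l mod d"
    if "u \<in> P" "v \<in> P" "(a ^^ i) u = (a ^^ l) v" "i \<le> l" for u v i l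
  proof -
    have "(a ^^ i) u = (a ^^ i) ((a ^^ (l - i)) v)"
      using that(3,4) by (metis funpow_add le_add_diff_inverse o_apply)
    then have eq: "u = (a ^^ (l - i)) v"
      using bij_funpow_a[of i] by (simp add: bij_def inj_eq)
    then have "v = u" using that a_separate orbit_a by metis
    moreover from this have "d dvd l - i"
      using eq d_dvd_period[OF that(1)] funpow_a_eq_self_iff[of "l - i" u] dvd_trans by metis
    ultimately show ?thesis
      using that(4) by (metis mod_eq_dvd_iff_nat)
  qed
  show ?thesis
    using *[OF assms] *[OF assms(2,1) assms(3)[symmetric]] by (metis nat_le_linear)
qed

text \<open>Reduction modulo \<open>d\<close> makes the chosen exponent irrelevant on
  \<open>S\<close>. Outside \<open>S\<close> the value is arbitrary but still below
  \<open>d\<close>.\<close>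

definition block :: "'a \<Rightarrow> nat" where
  "block y = (SOME k. \<exists>x\<in>P. y = (a ^^ k) x) mod d"

lemma block_funpow: "x \<in> P \<Longrightarrow> block ((a ^^ k) x) = k mod d"
  unfolding block_def
  by (rule someI2[where a = k]) (auto dest: funpow_a_inject)

lemma block_P: "x \<in> P \<Longrightarrow> block x = 0"
  using block_funpow[of x 0] by simp

lemma S_cases:
  assumes "y \<in> S"
  obtains x k where "x \<in> P" "y = (a ^^ k) x"
  using a_cover[OF assms] orbit_a by blast

lemma block_less: "block y < d"
  using d_pos by (simp add: block_def)

lemma block_funpow_a:
  assumes "y \<in> S"
  shows "block ((a ^^ j) y) = (block y + j) mod d"
proof -
  obtain x k where y: "x \<in> P" "y = (a ^^ k) x" using S_cases[OF assms] .
  have "block ((a ^^ (j + k)) x) = (j + k) mod d" using y by (simp add: block_funpow)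
  then show ?thesis using y by (simp add: block_funpow funpow_add mod_simps add.commute)
qed

lemma block_a: "y \<in> S \<Longrightarrow> block (a y) = Suc (block y) mod d"
  using block_funpow_a[of y 1] by simp

definition B :: "nat \<Rightarrow> 'a set" where
  "B i = {y \<in> S. block y = i}"

lemma B_subset: "B i \<subseteq> S"
  by (auto simp: B_def)

lemma finite_B: "finite (B i)"
  using finite_S B_subset by (rule finite_subset[rotated])

lemma P_subset_B: "P \<subseteq> B 0"
  using P_subset block_P by (auto simp: B_def)

lemma B_0_cases:
  assumes "y \<in> B 0"
  obtains x k where "x \<in> P" "y = (a ^^ (d * k)) x"
proof -
  obtain x j where "x \<in> P" "y = (a ^^ j) x" using assms S_cases by (auto simp: B_def)
  moreover from this have "d dvd j" using assms block_funpow by (auto simp: B_def)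
  ultimately show ?thesis using that by auto
qed

lemma funpow_a_in_S: "(a ^^ k) y \<in> S \<longleftrightarrow> y \<in> S"
  using permutes[OF funpow_closed[OF a_closed]] by (simp add: permutes_in_image)

lemma funpow_a_image_B:
  assumes "i < d"
  shows "(a ^^ i) ` B 0 = B i"
proof
  show "(a ^^ i) ` B 0 \<subseteq> B i"
    using assms by (auto simp: B_def funpow_a_in_S block_funpow_a)
  show "B i \<subseteq> (a ^^ i) ` B 0"
  proof
    fix y assume y: "y \<in> B i"
    then obtain x k where x: "x \<in> P" "y = (a ^^ k) x" using S_cases by (auto simp: B_def)
    then have "k mod d = i" using y by (auto simp: B_def block_funpow)
    then have "k = i + d * (k div d)" by (metis mod_mult_div_eq add.commute)
    then have "y = (a ^^ i) ((a ^^ (d * (k div d))) x)" using x(2) by (metis funpow_add o_apply)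
    moreover have "(a ^^ (d * (k div d))) x \<in> B 0"
      using x(1) P_subset by (auto simp: B_def block_funpow funpow_a_in_S)
    ultimately show "y \<in> (a ^^ i) ` B 0" by blast
  qed
qed

text \<open>Powers of \<open>a\<close> carry \<open>B 0\<close> onto each of the \<open>d\<close>
  blocks, so the number n/d of the theorem is the size of a block.\<close>

lemma card_S_eq: "card S = d * card (B 0)"
proof -
  have "S = (\<Union>i<d. B i)" using block_less by (auto simp: B_def)
  also have "card \<dots> = (\<Sum>i<d. card (B i))"
    by (rule card_UN_disjoint) (auto simp: finite_B, auto simp: B_def)
  also have "\<dots> = (\<Sum>i<d. card (B 0))"
  proof (rule sum.cong)
    fix i assume "i \<in> {..<d}"
    moreover have "inj_on (a ^^ i) (B 0)"
      using bij_funpow_a[of i] by (auto simp: bij_def intro: inj_on_subset)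
    ultimately show "card (B i) = card (B 0)"
      using card_image[of "a ^^ i" "B 0"] funpow_a_image_B[of i] by simp
  qed simp
  finally show ?thesis by simp
qed

section \<open>Conjugates of the 5-cycle and the first linked pair\<close>

definition conj_b :: "nat \<Rightarrow> 'a \<Rightarrow> 'a" where
  "conj_b k = a ^^ k \<circ> b \<circ> inv' (a ^^ k)"

lemma conj_b_closed: "conj_b k \<in> H"
  unfolding conj_b_def by (intro conj_closed funpow_closed a_closed b_closed)

lemma conj_b_apply: "conj_b k ((a ^^ k) y) = (a ^^ k) (b y)"
  using bij_funpow_a[of k] by (simp add: conj_b_def bij_is_inj)

lemma conj_b_fixes:
  assumes "y \<notin> (a ^^ k) ` P"
  shows "conj_b k y = y"
proof -
  have y: "(a ^^ k) (inv' (a ^^ k) y) = y"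
    using bij_funpow_a[of k] by (simp add: bij_is_surj surj_f_inv_f)
  then have "inv' (a ^^ k) y \<notin> P" using assms by (metis imageI)
  then show ?thesis using y by (simp add: conj_b_def b_fixes)
qed

lemma least_power_b: "x \<in> P \<Longrightarrow> least_power b x = 5"
  using card_cyclic_on[OF permutation_closed[OF b_closed] b_cyclic] card_P by simp

lemma b_5: "x \<in> P \<Longrightarrow> (b ^^ 5) x = x"
  using least_power_of_permutation(1)[OF permutation_closed[OF b_closed], of x] least_power_b by simp

lemma P_eq: "x \<in> P \<Longrightarrow> P = set (support b x)"
  using orbit_eq_set_support[OF permutation_closed[OF b_closed], of x] orbit_cyclic_eq3[OF b_cyclic]
  by blast

text \<open>Up to rotation, the periods around the vertex of degree 5 are \<open>rrrss\<close> or \<open>rrsrs\<close>.\<close>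

lemma ex_pattern:
  "\<exists>x0 x1 x2 x3 x4. P = {x0, x1, x2, x3, x4} \<and> distinct [x0, x1, x2, x3, x4] \<and>
     b x0 = x1 \<and> b x1 = x2 \<and> b x2 = x3 \<and> b x3 = x4 \<and> b x4 = x0 \<and>
     least_power a x0 = r \<and> least_power a x1 = r \<and> least_power a x4 = s \<and>
     (least_power a x2 = r \<and> least_power a x3 = s \<or> least_power a x2 = s \<and> least_power a x3 = r)"
proof -
  define R where "R x \<longleftrightarrow> least_power a x = r" for x
  have notR: "least_power a x = s" if "x \<in> P" "\<not> R x" for x
    using that a_period by (auto simp: R_def)
  obtain x where x: "x \<in> P" using card_P by fastforce
  define x1 where "x1 = b x"
  define x2 where "x2 = b x1"
  define x3 where "x3 = b x2"
  define x4 where "x4 = b x3"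
  have b4: "b x4 = x"
    using b_5[OF x] by (simp add: x1_def x2_def x3_def x4_def numeral_eq_Suc)
  have supp: "support b x = [x, x1, x2, x3, x4]"
    unfolding least_power_b[OF x]
    by (simp add: x1_def x2_def x3_def x4_def numeral_eq_Suc upt_rec)
  have P: "P = {x, x1, x2, x3, x4}" using P_eq[OF x] supp by simp
  have dist: "distinct [x, x1, x2, x3, x4]"
    using cycle_of_permutation[OF permutation_closed[OF b_closed], of x] supp by simp
  have "(\<Sum>y\<in>P. of_bool (R y) :: nat) = 3"
    using finite_P card_r by (simp add: Int_def R_def)
  moreover have "(\<Sum>y\<in>P. of_bool (R y) :: nat) =
      of_bool (R x) + of_bool (R x1) + of_bool (R x2) + of_bool (R x3) + of_bool (R x4)"
    unfolding P using dist by (simp del: sum_of_bool_eq)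
  ultimately have "of_bool (R x) + of_bool (R x1) + of_bool (R x2) + of_bool (R x3) + of_bool (R x4) = (3::nat)"
    by simp
  then have cases: "R x \<and> R x1 \<and> R x2 \<and> \<not> R x3 \<and> \<not> R x4 \<or> R x \<and> R x1 \<and> \<not> R x2 \<and> R x3 \<and> \<not> R x4 \<or>
    R x1 \<and> R x2 \<and> R x3 \<and> \<not> R x4 \<and> \<not> R x \<or> R x1 \<and> R x2 \<and> \<not> R x3 \<and> R x4 \<and> \<not> R x \<or>
    R x2 \<and> R x3 \<and> R x4 \<and> \<not> R x \<and> \<not> R x1 \<or> R x2 \<and> R x3 \<and> \<not> R x4 \<and> R x \<and> \<not> R x1 \<or>
    R x3 \<and> R x4 \<and> R x \<and> \<not> R x1 \<and> \<not> R x2 \<or> R x3 \<and> R x4 \<and> \<not> R x \<and> R x1 \<and> \<not> R x2 \<or>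
    R x4 \<and> R x \<and> R x1 \<and> \<not> R x2 \<and> \<not> R x3 \<or> R x4 \<and> R x \<and> \<not> R x1 \<and> R x2 \<and> \<not> R x3"
    by (rule three_of_five)
  \<comment> \<open>The two words read from a suitable starting point; the ten cases say that one of
    the five rotations of the cycle has this form.\<close>
  define Q where "Q y0 y1 y2 y3 y4 \<longleftrightarrow> R y0 \<and> R y1 \<and> \<not> R y4 \<and> (R y2 \<and> \<not> R y3 \<or> \<not> R y2 \<and> R y3)"
    for y0 y1 y2 y3 y4
  have rotations: "Q x x1 x2 x3 x4 \<or> Q x1 x2 x3 x4 x \<or> Q x2 x3 x4 x x1 \<or> Q x3 x4 x x1 x2 \<or> Q x4 x x1 x2 x3"
    using cases unfolding Q_def by blast
  have main: ?thesis
    if "Q y0 y1 y2 y3 y4" "P = {y0, y1, y2, y3, y4}" "distinct [y0, y1, y2, y3, y4]"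
      "b y0 = y1" "b y1 = y2" "b y2 = y3" "b y3 = y4" "b y4 = y0" for y0 y1 y2 y3 y4
  proof -
    have "least_power a y0 = r \<and> least_power a y1 = r \<and> least_power a y4 = s \<and>
      (least_power a y2 = r \<and> least_power a y3 = s \<or> least_power a y2 = s \<and> least_power a y3 = r)"
      using that(1,2) notR unfolding Q_def by (auto simp: R_def)
    then show ?thesis using that(2-) by blast
  qed
  have bs: "b x = x1" "b x1 = x2" "b x2 = x3" "b x3 = x4"
    by (simp_all only: x1_def x2_def x3_def x4_def)
  show ?thesis
    using rotations
  proof (elim disjE)
    assume "Q x x1 x2 x3 x4"
    then show ?thesis by (rule main) (use P dist bs b4 in auto)
  next
    assume "Q x1 x2 x3 x4 x"
    then show ?thesis by (rule main) (use P dist bs b4 in auto)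
  next
    assume "Q x2 x3 x4 x x1"
    then show ?thesis by (rule main) (use P dist bs b4 in auto)
  next
    assume "Q x3 x4 x x1 x2"
    then show ?thesis by (rule main) (use P dist bs b4 in auto)
  next
    assume "Q x4 x x1 x2 x3"
    then show ?thesis by (rule main) (use P dist bs b4 in auto)
  qed
qed

lemma funpow_a_notin_P: "x \<in> P \<Longrightarrow> \<not> least_power a x dvd k \<Longrightarrow> (a ^^ k) x \<notin> P"
  by (simp add: funpow_a_in_P_iff)

lemma funpow_a_eq_iff: "(a ^^ k) x = (a ^^ k) y \<longleftrightarrow> x = y"
  using bij_funpow_a[of k] by (simp add: bij_def inj_eq)

text \<open>If \<open>s\<close> does not divide \<open>r\<close>, then \<open>a ^^ r\<close> fixes
  the three points of period \<open>r\<close> and moves the other two off \<open>P\<close>.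
  Otherwise \<open>r\<close> does not divide \<open>s\<close>, and \<open>a ^^ s\<close> fixes two
  points and moves three off \<open>P\<close>. With two arrangements of the periods in each case,
  the four word lemmas apply.\<close>

lemma ex_linked_in_P: "\<exists>x\<in>P. \<exists>y\<in>P. x \<noteq> y \<and> linked x y"
proof -
  obtain x0 x1 x2 x3 x4 where P: "P = {x0, x1, x2, x3, x4}" and dist: "distinct [x0, x1, x2, x3, x4]"
    and bs: "b x0 = x1" "b x1 = x2" "b x2 = x3" "b x3 = x4" "b x4 = x0"
    and rs: "least_power a x0 = r" "least_power a x1 = r" "least_power a x4 = s"
    and pattern: "least_power a x2 = r \<and> least_power a x3 = s \<or> least_power a x2 = s \<and> least_power a x3 = r"
    using ex_pattern by metis
  have b_fix: "y \<notin> {x0, x1, x2, x3, x4} \<Longrightarrow> b y = y" for y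
    using b_fixes P by simp
  have inP: "x0 \<in> P" "x1 \<in> P" "x2 \<in> P" "x3 \<in> P" "x4 \<in> P" using P by auto
  show ?thesis
  proof (cases "s dvd r")
    case False
    define A where "A = a ^^ r"
    have fixed: "A x = x" if "least_power a x = r" for x
      using that unfolding A_def by (simp add: funpow_a_eq_self_iff)
    have moved: "A x \<notin> P" if "least_power a x = s" "x \<in> P" for x
      using that False unfolding A_def by (simp add: funpow_a_notin_P)
    have A_eq: "A x = A y \<longleftrightarrow> x = y" for x y
      unfolding A_def by (rule funpow_a_eq_iff)
    \<comment> \<open>The conjugate runs through the same cycle with every moved point
      \<open>x\<close> replaced by \<open>A x\<close>; this is the cycle \<open>e\<close> of the
      word lemmas.\<close>
    have e: "conj_b r (A y) = A (b y)" for y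
      unfolding A_def by (rule conj_b_apply)
    have e_fix: "y \<notin> {A x0, A x1, A x2, A x3, A x4} \<Longrightarrow> conj_b r y = y" for y
      using conj_b_fixes[of y r] unfolding P A_def by simp
    from pattern show ?thesis
    proof (elim disjE conjE)
      assume p: "least_power a x2 = r" "least_power a x3 = s"
      have "linked x0 x4"
      proof (rule linked_from_two_moved_consecutive[OF b_closed conj_b_closed[of r], of x0 x1 x2 x3 x4 "A x3" "A x4"])
        show "distinct [x0, x1, x2, x3, x4, A x3, A x4]"
          using dist moved[of x3] moved[of x4] p rs inP A_eq[of x3 x4] unfolding P by auto
      qed (use bs e[of x0] e[of x1] e[of x2] e[of x3] e[of x4] e_fix b_fix
            fixed[of x0] fixed[of x1] fixed[of x2] p rs in simp_all)
      then show ?thesis using inP dist by auto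
    next
      assume p: "least_power a x2 = s" "least_power a x3 = r"
      have "linked x0 x2"
      proof (rule linked_from_two_moved_apart[OF b_closed conj_b_closed[of r], of x0 x1 x2 x3 x4 "A x2" "A x4"])
        show "distinct [x0, x1, x2, x3, x4, A x2, A x4]"
          using dist moved[of x2] moved[of x4] p rs inP A_eq[of x2 x4] unfolding P by auto
      qed (use bs e[of x0] e[of x1] e[of x2] e[of x3] e[of x4] e_fix b_fix
            fixed[of x0] fixed[of x1] fixed[of x3] p rs in simp_all)
      then show ?thesis using inP dist by auto
    qed
  next
    case True
    then have False': "\<not> r dvd s" using r_neq_s dvd_antisym by blast
    define A where "A = a ^^ s"
    have fixed: "A x = x" if "least_power a x = s" for x
      using that unfolding A_def by (simp add: funpow_a_eq_self_iff)
    have moved: "A x \<notin> P" if "least_power a x = r" "x \<in> P" for x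
      using that False' unfolding A_def by (simp add: funpow_a_notin_P)
    have A_eq: "A x = A y \<longleftrightarrow> x = y" for x y
      unfolding A_def by (rule funpow_a_eq_iff)
    have e: "conj_b s (A y) = A (b y)" for y
      unfolding A_def by (rule conj_b_apply)
    have e_fix: "y \<notin> {A x0, A x1, A x2, A x3, A x4} \<Longrightarrow> conj_b s y = y" for y
      using conj_b_fixes[of y s] unfolding P A_def by simp
    from pattern show ?thesis
    proof (elim disjE conjE)
      assume p: "least_power a x2 = r" "least_power a x3 = s"
      have "linked x0 x1"
      proof (rule linked_from_three_moved_consecutive[OF b_closed conj_b_closed[of s],
              of x0 x1 x2 x3 x4 "A x0" "A x1" "A x2"])
        show "distinct [x0, x1, x2, x3, x4, A x0, A x1, A x2]"
          using dist moved[of x0] moved[of x1] moved[of x2] p rs inP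
            A_eq[of x0 x1] A_eq[of x0 x2] A_eq[of x1 x2] unfolding P by auto
      qed (use bs e[of x0] e[of x1] e[of x2] e[of x3] e[of x4] e_fix b_fix
            fixed[of x3] fixed[of x4] p rs in simp_all)
      then show ?thesis using inP dist by auto
    next
      assume p: "least_power a x2 = s" "least_power a x3 = r"
      have "linked x0 x2"
      proof (rule linked_from_three_moved_apart[OF b_closed conj_b_closed[of s],
              of x0 x1 x2 x3 x4 "A x0" "A x1" "A x3"])
        show "distinct [x0, x1, x2, x3, x4, A x0, A x1, A x3]"
          using dist moved[of x0] moved[of x1] moved[of x3] p rs inP
            A_eq[of x0 x1] A_eq[of x0 x3] A_eq[of x1 x3] unfolding P by auto
      qed (use bs e[of x0] e[of x1] e[of x2] e[of x3] e[of x4] e_fix b_fix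
            fixed[of x2] fixed[of x4] p rs in simp_all)
      then show ?thesis using inP dist by auto
    qed
  qed
qed

text \<open>The two points of a linked pair in \<open>P\<close> differ by some \<open>b ^^ j\<close>
  with \<open>j\<close> prime to 5. Linkage is invariant under \<open>b\<close>, so steps of length
  \<open>j\<close> reach the whole 5-cycle.\<close>

lemma linked_P:
  assumes "u \<in> P" "v \<in> P"
  shows "linked u v"
proof -
  obtain x y where xy: "x \<in> P" "y \<in> P" "x \<noteq> y" "linked x y" using ex_linked_in_P by blast
  have reach: "\<exists>k<5. z = (b ^^ k) x" if "z \<in> P" for z
  proof -
    have "z \<in> set (support b x)" using that P_eq[OF xy(1)] by blast
    then have "z \<in> (\<lambda>k. (b ^^ k) x) ` {0..<5}"
      by (simp only: set_map set_upt least_power_b[OF xy(1)])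
    then show ?thesis by (elim imageE) (use atLeastLessThan_iff in blast)
  qed
  obtain j where j: "j < 5" "y = (b ^^ j) x" using reach[OF xy(2)] by blast
  have "0 < j" using j xy(3) by (cases j) auto
  have steps: "linked x ((b ^^ (j * i)) x)" for i
  proof (induction i)
    case (Suc i)
    have "linked ((b ^^ (j * i)) x) ((b ^^ (j * i)) y)"
      using xy(4) funpow_closed[OF b_closed] by (rule linked_image)
    moreover have "(b ^^ (j * Suc i)) x = (b ^^ (j * i)) y"
      unfolding j(2) by (metis add.commute funpow_add mult_Suc_right o_apply)
    ultimately have "linked ((b ^^ (j * i)) x) ((b ^^ (j * Suc i)) x)" by simp
    then show ?case using Suc linked_trans by blast
  qed (simp add: linked_refl)
  have "linked x z" if z: "z \<in> P" for z
  proof -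
    obtain k where k: "k < 5" "z = (b ^^ k) x" using reach[OF z] by blast
    \<comment> \<open>\<open>j ^ 3\<close> inverts \<open>j\<close> modulo 5\<close>
    have "j \<in> {1, 2, 3, 4}" using j(1) \<open>0 < j\<close> by auto
    then have "j ^ 4 mod 5 = 1" by auto
    moreover have "j * (k * j ^ 3) = j ^ 4 * k" by (simp add: eval_nat_numeral algebra_simps)
    ultimately have "(j * (k * j ^ 3)) mod 5 = k mod 5"
      by (metis mod_mult_left_eq mult_1)
    then have "(b ^^ (j * (k * j ^ 3))) x = z"
      using k funpow_mod_eq[OF b_5[OF xy(1)]] by (metis mod_less)
    then show ?thesis using steps by metis
  qed
  then show ?thesis using assms linked_sym linked_trans by blast
qed

text \<open>The exponents for which the power of \<open>a\<close> keeps \<open>P\<close> within its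
  linkage class are closed under sums and differences. They include \<open>r\<close> and
  \<open>s\<close>, because \<open>a ^^ r\<close> and \<open>a ^^ s\<close> each fix a point of
  \<open>P\<close> and so map the class to one that meets it; Bezout then gives
  \<open>d\<close>.\<close>

lemma linked_funpow_d:
  assumes "x \<in> P"
  shows "linked x ((a ^^ (d * k)) x)"
proof -
  define stab where "stab k \<longleftrightarrow> (\<forall>x\<in>P. linked x ((a ^^ k) x))" for k
  have img: "linked ((a ^^ k) x) ((a ^^ k) y) \<longleftrightarrow> linked x y" for k x y
    by (rule linked_image_iff[OF funpow_closed[OF a_closed]])
  have stabI: "stab k" if "u \<in> P" "(a ^^ k) u = u" for k u
    unfolding stab_def
  proof
    fix x assume "x \<in> P"
    then have "linked ((a ^^ k) u) ((a ^^ k) x)" "linked x u"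
      using that(1) img linked_P by blast+
    then show "linked x ((a ^^ k) x)" using that(2) linked_trans by metis
  qed
  have add: "stab (j + k)" if "stab j" "stab k" for j k
    using that img linked_trans unfolding stab_def funpow_add o_apply by blast
  have diff: "stab k" if "stab (j + k)" "stab j" for j k
    using that img linked_trans linked_sym unfolding stab_def funpow_add o_apply by blast
  have mult: "stab (j * k)" if "stab j" for j k
    by (induction k) (use that add in \<open>auto simp: stab_def linked_refl\<close>)
  \<comment> \<open>The count 3 is neither 0 nor 5, so both periods occur in
    \<open>P\<close>.\<close>
  have "card {x \<in> P. least_power a x = r} \<noteq> card {}" "card {x \<in> P. least_power a x = r} \<noteq> card P"
    unfolding card_r card_P by simp_all
  then have "{x \<in> P. least_power a x = r} \<noteq> {}" "{x \<in> P. least_power a x = r} \<noteq> P"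
    by metis+
  then obtain u v where u: "u \<in> P" "least_power a u = r" and v: "v \<in> P" "least_power a v = s"
    using a_period by blast
  have rs: "stab r" "stab s"
    using stabI[of u r] stabI[of v s] u v funpow_a_eq_self_iff by auto
  obtain i j where "r * i = s * j + d"
    using bezout_nat[of r s] r_pos by (auto simp: d_def)
  then have "stab d"
    using diff[of "s * j" d] mult[OF rs(1), of i] mult[OF rs(2), of j] by simp
  then show ?thesis using mult[of d k] assms by (simp add: stab_def)
qed

lemma linked_B:
  assumes "i < d" "x \<in> B i" "y \<in> B i"
  shows "linked x y"
proof -
  have B0: "linked u v" if u: "u \<in> B 0" and v: "v \<in> B 0" for u v
  proof -
    obtain x k where x: "x \<in> P" "u = (a ^^ (d * k)) x" using B_0_cases[OF u] .
    obtain y j where y: "y \<in> P" "v = (a ^^ (d * j)) y" using B_0_cases[OF v] .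
    show ?thesis
      using linked_funpow_d[OF x(1)] linked_funpow_d[OF y(1)] linked_P[OF x(1) y(1)] x y
        linked_sym linked_trans by metis
  qed
  obtain u v where "u \<in> B 0" "v \<in> B 0" "x = (a ^^ i) u" "y = (a ^^ i) v"
    using assms funpow_a_image_B[OF assms(1)] by blast
  then show ?thesis using B0 linked_image funpow_closed[OF a_closed] by blast
qed

lemma even_block_permutation_closed:
  assumes "i < d" "p permutes B i" "evenperm p"
  shows "p \<in> H"
  using finite_B assms(2,3) linked_B[OF assms(1)] by (rule even_permutation_closed)

end

section \<open>The normal subgroup and its complement\<close>

lemma perm_restrict_permutes:
  assumes "bij g" "g ` A = A"
  shows "perm_restrict g A permutes A"
proof (rule bij_imp_permutes)
  show "bij_betw (perm_restrict g A) A A"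
    using assms by (auto simp: bij_betw_def inj_on_def bij_def inj_def perm_restrict_def)
qed (simp add: perm_restrict_def)

lemma perm_restrict_comp_image:
  "h ` A \<subseteq> A \<Longrightarrow> perm_restrict (g \<circ> h) A = perm_restrict g A \<circ> perm_restrict h A"
  by (auto simp: perm_restrict_def fun_eq_iff)

lemma perm_restrict_conj:
  assumes "bij h"
  shows "perm_restrict (h \<circ> g \<circ> inv' h) (h ` A) = h \<circ> perm_restrict g A \<circ> inv' h"
proof
  fix y
  obtain x where "y = h x" using assms by (auto simp: bij_def)
  then show "perm_restrict (h \<circ> g \<circ> inv' h) (h ` A) y = (h \<circ> perm_restrict g A \<circ> inv' h) y"
    using assms by (auto simp: perm_restrict_def bij_def inj_image_mem_iff)
qed

lemma evenperm_conj:
  "permutation h \<Longrightarrow> permutation g \<Longrightarrow> evenperm (h \<circ> g \<circ> inv' h) \<longleftrightarrow> evenperm g"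
  by (auto simp: evenperm_comp evenperm_inv permutation_inverse permutation_compose)

context five_star_group begin

lemma permutation_S: "g permutes S \<Longrightarrow> permutation g"
  using finite_S by (auto simp: permutation_permutes)

lemma permutation_B: "g permutes B i \<Longrightarrow> permutation g"
  using finite_B by (auto simp: permutation_permutes)

text \<open>The internal direct product of the alternating groups of the blocks. Describing it by
  conditions on each block lets normality and non-membership be read off from signs of
  restrictions.\<close>

definition block_alt :: "('a \<Rightarrow> 'a) set" where
  "block_alt = {g. g permutes S \<and> (\<forall>y\<in>S. block (g y) = block y) \<and>
        (\<forall>i<d. evenperm (perm_restrict g (B i)))}"

text \<open>The predicate \<open>Q\<close> on block indices covers both single blocks and the unions
  of initial blocks in \<open>block_alt_closed\<close>.\<close>

lemma image_eq_of_block_preserving: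
  assumes "g permutes S" "\<And>y. y \<in> S \<Longrightarrow> block (g y) = block y"
  shows "g ` {y \<in> S. Q (block y)} = {y \<in> S. Q (block y)}"
proof (rule endo_inj_surj)
  show "g ` {y \<in> S. Q (block y)} \<subseteq> {y \<in> S. Q (block y)}"
    using assms by (auto simp: permutes_in_image)
qed (use finite_S assms(1) in \<open>auto intro: inj_on_subset[OF permutes_inj]\<close>)

lemma block_alt_image_B: "g \<in> block_alt \<Longrightarrow> g ` B i = B i"
  using image_eq_of_block_preserving[of g "\<lambda>j. j = i"] by (auto simp: block_alt_def B_def)

lemma block_alt_restrict_permutes: "g \<in> block_alt \<Longrightarrow> perm_restrict g (B i) permutes B i"
  using perm_restrict_permutes[OF _ block_alt_image_B] by (auto simp: block_alt_def intro: permutes_bij)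

lemma block_alt_evenperm: "g \<in> block_alt \<Longrightarrow> i < d \<Longrightarrow> evenperm (perm_restrict g (B i))"
  by (simp add: block_alt_def)

lemma block_alt_restrict_permutation: "g \<in> block_alt \<Longrightarrow> permutation (perm_restrict g (B i))"
  using block_alt_restrict_permutes permutation_B by blast

lemma block_alt_closed: "block_alt \<subseteq> H"
proof
  fix g assume g: "g \<in> block_alt"
  have gS: "g permutes S" and gb: "block (g y) = block y" if "y \<in> S" for y
    using g that by (auto simp: block_alt_def)
  have "g permutes S" using g by (simp add: block_alt_def)
  \<comment> \<open>\<open>g\<close> is assembled block by block, each time by an even permutation
    of block \<open>k\<close>, which \<open>H\<close> contains.\<close>
  have "perm_restrict g {y \<in> S. block y < k} \<in> H" if "k \<le> d" for k
    using that
  proof (induction k)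
    case 0
    have "perm_restrict g {y \<in> S. block y < 0} = id" by (auto simp: perm_restrict_def)
    then show ?case using id_closed by (simp only:)
  next
    case (Suc k)
    have "perm_restrict g (B k) \<in> H"
      using Suc.prems g block_alt_restrict_permutes[OF g] by (intro even_block_permutation_closed[of k]) (auto simp: block_alt_def)
    moreover have "perm_restrict g (B k) \<circ> perm_restrict g {y \<in> S. block y < k} =
        perm_restrict g (B k \<union> {y \<in> S. block y < k})"
    proof (rule perm_restrict_union)
      show "perm_restrict g {y \<in> S. block y < k} permutes {y \<in> S. block y < k}"
        using \<open>g permutes S\<close> image_eq_of_block_preserving[of g "\<lambda>j. j < k"] gb
        by (intro perm_restrict_permutes) (auto intro: permutes_bij)
    qed (use block_alt_restrict_permutes[OF g] in \<open>auto simp: B_def\<close>)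
    moreover have "B k \<union> {y \<in> S. block y < k} = {y \<in> S. block y < Suc k}" by (auto simp: B_def)
    moreover have "perm_restrict g {y \<in> S. block y < k} \<in> H" using Suc by simp
    ultimately show ?case using comp_closed by metis
  qed
  moreover have "{y \<in> S. block y < d} = S" using block_less by auto
  ultimately show "g \<in> H" using \<open>g permutes S\<close> by (metis order_refl perm_restrict_id)
qed

lemma block_alt_comp: "g \<in> block_alt \<Longrightarrow> h \<in> block_alt \<Longrightarrow> g \<circ> h \<in> block_alt"
proof -
  assume g: "g \<in> block_alt" and h: "h \<in> block_alt"
  have "evenperm (perm_restrict (g \<circ> h) (B i))" if "i < d" for i
  proof -
    have "perm_restrict (g \<circ> h) (B i) = perm_restrict g (B i) \<circ> perm_restrict h (B i)"
      using block_alt_image_B[OF h] by (intro perm_restrict_comp_image) auto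
    then show ?thesis
      using evenperm_comp[OF block_alt_restrict_permutation[OF g] block_alt_restrict_permutation[OF h]]
        block_alt_evenperm[OF g that] block_alt_evenperm[OF h that] by simp
  qed
  then show "g \<circ> h \<in> block_alt"
    using g h by (auto simp: block_alt_def permutes_compose permutes_in_image)
qed

lemma block_alt_id: "id \<in> block_alt"
proof -
  have "perm_restrict id A = id" for A :: "'a set" by (auto simp: perm_restrict_def)
  then show ?thesis by (simp add: block_alt_def permutes_id)
qed

lemma block_alt_inv:
  assumes "g \<in> block_alt"
  shows "inv' g \<in> block_alt"
proof -
  have g: "g permutes S" using assms by (simp add: block_alt_def)
  have inv: "inv' g permutes S" using g by (rule permutes_inv)
  have blk: "block (inv' g y) = block y" if "y \<in> S" for y
  proof -
    have "inv' g y \<in> S" using inv that by (simp add: permutes_in_image)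
    then have "block (g (inv' g y)) = block (inv' g y)" using assms by (simp add: block_alt_def)
    then show ?thesis using g by (simp add: permutes_inverses)
  qed
  have "evenperm (perm_restrict (inv' g) (B i))" if "i < d" for i
  proof -
    have "inv' g ` B i = B i"
      using image_eq_of_block_preserving[OF inv blk, of "\<lambda>j. j = i"] by (simp add: B_def)
    then have p: "perm_restrict (inv' g) (B i) permutes B i"
      by (intro perm_restrict_permutes permutes_bij[OF inv])
    have "perm_restrict (inv' g \<circ> g) (B i) = perm_restrict (inv' g) (B i) \<circ> perm_restrict g (B i)"
      using block_alt_image_B[OF assms] by (intro perm_restrict_comp_image) auto
    moreover have "perm_restrict (inv' g \<circ> g) (B i) = id"
      using g by (auto simp: permutes_inv_o perm_restrict_def)
    ultimately have "evenperm (perm_restrict (inv' g) (B i) \<circ> perm_restrict g (B i))" by simp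
    then show ?thesis
      using evenperm_comp[OF permutation_B[OF p] block_alt_restrict_permutation[OF assms]]
        block_alt_evenperm[OF assms that] by simp
  qed
  then show ?thesis using inv blk by (simp add: block_alt_def)
qed

lemma shift_image_B:
  assumes "h permutes S" "\<And>y. y \<in> S \<Longrightarrow> block (h y) = Suc (block y) mod d" "i < d"
  obtains j where "j < d" "h ` B j = B i"
proof
  \<comment> \<open>The cyclic predecessor of \<open>i\<close> modulo \<open>d\<close>.\<close>
  define j where "j = (if i = 0 then d - 1 else i - 1)"
  show "j < d" using assms(3) by (auto simp: j_def)
  have *: "Suc k mod d = i \<longleftrightarrow> k = j" if "k < d" for k
    using that assms(3) d_pos by (cases "Suc k = d") (auto simp: j_def)
  show "h ` B j = B i"
  proof
    show "h ` B j \<subseteq> B i"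
    proof
      fix y assume "y \<in> h ` B j"
      then obtain x where x: "y = h x" "x \<in> S" "block x = j" by (auto simp: B_def)
      then show "y \<in> B i"
        using assms(1) assms(2)[OF x(2)] *[OF \<open>j < d\<close>] by (simp add: B_def permutes_in_image)
    qed
    show "B i \<subseteq> h ` B j"
    proof
      fix y assume y: "y \<in> B i"
      obtain x where x: "y = h x" using assms(1) by (metis permutes_surj surjD)
      then have "x \<in> S" using y assms(1) by (simp add: B_def permutes_in_image)
      then have "x \<in> B j" using assms(2) y x *[of "block x"] block_less by (auto simp: B_def)
      then show "y \<in> h ` B j" using x by blast
    qed
  qed
qed

text \<open>On block \<open>i\<close> the conjugate is the conjugate of the restriction of
  \<open>g\<close> to the preceding block, so its sign is unchanged.\<close>

lemma block_alt_conj: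
  assumes "h permutes S" "\<And>y. y \<in> S \<Longrightarrow> block (h y) = Suc (block y) mod d" "g \<in> block_alt"
  shows "h \<circ> g \<circ> inv' h \<in> block_alt"
proof -
  have g: "g permutes S" using assms by (simp add: block_alt_def)
  have bh: "bij h" using assms(1) by (rule permutes_bij)
  have "block ((h \<circ> g \<circ> inv' h) y) = block y" if "y \<in> S" for y
  proof -
    define x where "x = inv' h y"
    have x: "y = h x" using assms(1) by (simp add: x_def permutes_inverses)
    then have "x \<in> S" using that assms(1) by (simp add: permutes_in_image)
    moreover from this have "g x \<in> S" using g by (simp add: permutes_in_image)
    moreover have "block (g x) = block x" using assms(3) \<open>x \<in> S\<close> by (simp add: block_alt_def)
    moreover have "(h \<circ> g \<circ> inv' h) y = h (g x)" by (simp add: x_def)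
    ultimately show ?thesis using assms(2)[of x] assms(2)[of "g x"] x by metis
  qed
  moreover have "evenperm (perm_restrict (h \<circ> g \<circ> inv' h) (B i))" if i: "i < d" for i
  proof -
    obtain j where j: "j < d" "h ` B j = B i"
      using shift_image_B[OF assms(1,2) i] by metis
    have "evenperm (h \<circ> perm_restrict g (B j) \<circ> inv' h)"
      using evenperm_conj permutation_S[OF assms(1)] block_alt_restrict_permutation[OF assms(3)]
        block_alt_evenperm[OF assms(3) j(1)] by blast
    then show ?thesis using perm_restrict_conj[OF bh, of g "B j"] j(2) by simp
  qed
  moreover have "h \<circ> g \<circ> inv' h permutes S"
    by (intro permutes_compose permutes_inv assms(1) g)
  ultimately show ?thesis by (simp add: block_alt_def)
qed

lemma even_block_permutation_in_block_alt:
  assumes "i < d" "p permutes B i" "evenperm p"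
  shows "p \<in> block_alt"
proof -
  have "block (p y) = block y" for y
    using assms(2) permutes_not_in[OF assms(2)] permutes_in_image[OF assms(2), of y]
    by (cases "y \<in> B i") (auto simp: B_def)
  moreover have "perm_restrict p (B j) = (if j = i then p else id)" for j
    using assms(2) by (auto simp: perm_restrict_def B_def fun_eq_iff dest: permutes_not_in)
  moreover have "p permutes S" using assms(2) B_subset by (rule permutes_subset)
  ultimately show ?thesis using assms(3) by (simp add: block_alt_def)
qed

lemma b_in_block_alt: "b \<in> block_alt"
proof -
  have bP: "b permutes P"
    by (rule permutes_superset[OF permutes[OF b_closed]]) (simp add: b_fixes)
  obtain x where x: "x \<in> P" using card_P by fastforce
  \<comment> \<open>On \<open>P\<close> there is a single orbit, so \<open>{x}\<close> is a
    transversal, and 5 + 1 is even.\<close>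
  have "evenperm b \<longleftrightarrow> even (card P + card {x})"
    using bP x finite_P orbit_cyclic_eq3[OF b_cyclic x]
    by (intro evenperm_iff_even_card_transversal) auto
  then have "evenperm b" using card_P by simp
  then show ?thesis
    using d_pos permutes_subset[OF bP P_subset_B] by (intro even_block_permutation_in_block_alt[of 0]) auto
qed

section \<open>The sign of the first return and the cyclic complement\<close>

text \<open>The first-return map of \<open>a\<close> to \<open>B 0\<close>: smaller positive powers
  of \<open>a\<close> carry \<open>B 0\<close> to other blocks.\<close>

definition return :: "'a \<Rightarrow> 'a" where
  "return = perm_restrict (a ^^ d) (B 0)"

lemma return_permutes: "return permutes B 0"
proof -
  have "(a ^^ d) ` B 0 = B 0"
  proof (rule endo_inj_surj)
    show "(a ^^ d) ` B 0 \<subseteq> B 0"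
      by (auto simp: B_def funpow_a_in_S block_funpow_a)
    show "inj_on (a ^^ d) (B 0)"
      using bij_funpow_a[of d] by (auto simp: bij_def intro: inj_on_subset)
  qed (rule finite_B)
  then show ?thesis unfolding return_def by (intro perm_restrict_permutes bij_funpow_a)
qed

lemma return_apply: "y \<in> B 0 \<Longrightarrow> return y = (a ^^ d) y"
  by (simp add: return_def perm_restrict_def)

lemma return_funpow: "y \<in> B 0 \<Longrightarrow> (return ^^ k) y = (a ^^ (d * k)) y"
proof (induction k)
  case (Suc k)
  have "(a ^^ (d * k)) y \<in> B 0"
    using Suc.prems by (auto simp: B_def funpow_a_in_S block_funpow_a)
  then have "(return ^^ Suc k) y = (a ^^ d) ((a ^^ (d * k)) y)"
    using Suc by (simp add: return_apply)
  also have "\<dots> = (a ^^ (d + d * k)) y" by (simp only: funpow_add o_apply)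
  finally show ?case by simp
qed simp

text \<open>Each cycle of \<open>a\<close> meets \<open>B 0\<close> in a single cycle of
  \<open>return\<close>, so \<open>P\<close> is a transversal here too. Since its size 5 is odd, the
  sign depends on the parity of the block size, which decides between \<open>d\<close> and
  \<open>2 * d\<close>.\<close>

lemma evenperm_return: "evenperm return \<longleftrightarrow> odd (card (B 0))"
proof -
  have orb: "y \<in> orbit return x \<longleftrightarrow> (\<exists>k. y = (return ^^ k) x)" for x y
    using permutation_B[OF return_permutes] by (auto simp: orbit_altdef_permutation)
  have "evenperm return \<longleftrightarrow> even (card (B 0) + card P)"
  proof (rule evenperm_iff_even_card_transversal[OF finite_P finite_B return_permutes P_subset_B])
    fix y assume "y \<in> B 0"
    then obtain x k where x: "x \<in> P" "y = (a ^^ (d * k)) x" by (rule B_0_cases)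
    then have "y = (return ^^ k) x" using P_subset_B return_funpow[of x k] by auto
    then show "\<exists>x\<in>P. y \<in> orbit return x" using x orb by blast
  next
    fix x y assume xy: "x \<in> P" "y \<in> P" "y \<in> orbit return x"
    then obtain k where "y = (return ^^ k) x" using orb by blast
    then have "y = (a ^^ (d * k)) x" using xy(1) P_subset_B return_funpow[of x k] by auto
    then show "x = y" using a_separate[OF xy(1,2)] orbit_a by blast
  qed
  then show ?thesis using card_P by simp
qed

text \<open>\<open>w\<close> is the intended first return after the correction of \<open>a\<close>.
  An even correction preserves the sign, so \<open>w\<close> is the identity when that is possible
  and otherwise a transposition, whose square is trivial.\<close>

lemma ex_involution:
  "\<exists>w. w permutes B 0 \<and> w \<circ> w = id \<and> evenperm w = evenperm return \<and> (evenperm return \<longrightarrow> w = id)"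
proof (cases "evenperm return")
  case True
  then show ?thesis by (intro exI[of _ id]) (simp add: permutes_id)
next
  case False
  obtain u v where uv: "u \<in> P" "v \<in> P" "u \<noteq> v" using ex_linked_in_P by blast
  then have "transpose u v permutes B 0" using P_subset_B by (intro permutes_swap_id) auto
  then show ?thesis using False uv by (intro exI[of _ "transpose u v"]) (simp add: evenperm_swap)
qed

text \<open>Composing \<open>a\<close> with a permutation \<open>q\<close> of \<open>B 0\<close>
  changes the first return from \<open>return\<close> to \<open>return \<circ> q\<close>;
  \<open>q\<close> is chosen to make this \<open>w\<close>, and equal signs make \<open>q\<close>
  even. On every other block \<open>h ^^ d\<close> is conjugate to \<open>w\<close> by a power of
  \<open>h\<close>.\<close>

lemma ex_complement:
  defines "K \<equiv> if even (card (B 0)) then 2 * d else d"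
  shows "\<exists>h\<in>H. h ^^ K = id \<and> (\<forall>j. 0 < j \<longrightarrow> j < K \<longrightarrow> h ^^ j \<notin> block_alt) \<and>
           (\<forall>y\<in>S. block (h y) = Suc (block y) mod d) \<and> (\<exists>g\<in>block_alt. h = a \<circ> g)"
proof -
  obtain w where w: "w permutes B 0" "w \<circ> w = id" "evenperm w = evenperm return" "evenperm return \<Longrightarrow> w = id"
    using ex_involution by blast
  define q where "q = inv' return \<circ> w"
  have q_permutes: "q permutes B 0"
    unfolding q_def using w(1) permutes_inv[OF return_permutes] by (rule permutes_compose)
  have "evenperm q"
    unfolding q_def using w permutation_B[OF return_permutes] permutation_B[OF w(1)]
    by (simp add: evenperm_comp evenperm_inv permutation_inverse)
  then have qN: "q \<in> block_alt" using q_permutes d_pos by (intro even_block_permutation_in_block_alt[of 0])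
  define h where "h = a \<circ> q"
  have hH: "h \<in> H" unfolding h_def using a_closed qN block_alt_closed comp_closed by blast
  have h_S: "h permutes S" using permutes[OF hH] .
  have shift: "block (h y) = Suc (block y) mod d" if y: "y \<in> S" for y
  proof -
    have "q y \<in> S" "block (q y) = block y" using qN y by (auto simp: block_alt_def permutes_in_image)
    then show ?thesis by (simp add: h_def block_a)
  qed
  have shift_pow: "block ((h ^^ k) y) = (block y + k) mod d" if "y \<in> S" for k y
  proof (induction k)
    case (Suc k)
    have "(h ^^ k) y \<in> S" using that permutes[OF funpow_closed[OF hH]] by (simp add: permutes_in_image)
    then show ?case using Suc shift by (simp add: mod_Suc_eq)
  qed (use block_less in simp)
  \<comment> \<open>From a point of \<open>B 0\<close>, \<open>q\<close> acts in the first step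
    only, since the next visit to \<open>B 0\<close> comes after \<open>d\<close> steps. The
    exponent starts at 1 because \<open>q\<close> has not yet acted at exponent 0.\<close>
  have h_pow: "(h ^^ Suc k) z = (a ^^ Suc k) (q z)" if z: "z \<in> B 0" and "Suc k \<le> d" for k z
    using that(2)
  proof (induction k)
    case (Suc k)
    have "q z \<in> B 0" using q_permutes z by (simp add: permutes_in_image)
    then have "block ((a ^^ Suc k) (q z)) = Suc k mod d"
      by (subst block_funpow_a) (auto simp: B_def)
    then have "(a ^^ Suc k) (q z) \<notin> B 0" using Suc.prems by (simp add: B_def)
    then have "q ((a ^^ Suc k) (q z)) = (a ^^ Suc k) (q z)" using q_permutes by (rule permutes_not_in[rotated])
    moreover have "(h ^^ Suc (Suc k)) z = h ((h ^^ Suc k) z)" by simp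
    ultimately show ?case using Suc by (simp only: h_def o_apply) simp
  qed (simp add: h_def)
  have h_d: "(h ^^ d) z = w z" if z: "z \<in> B 0" for z
  proof -
    have "q z \<in> B 0" using q_permutes z by (simp add: permutes_in_image)
    then have "(h ^^ d) z = return (q z)" using h_pow[OF z, of "d - 1"] d_pos by (simp add: return_apply)
    also have "return (q z) = w z" unfolding q_def o_apply using return_permutes by (rule permutes_inverses)
    finally show ?thesis .
  qed
  \<comment> \<open>\<open>h ^^ d\<close> commutes with the power of \<open>h\<close> that leads
    from \<open>B 0\<close> to \<open>y\<close>, which carries \<open>h_d\<close> to all
    blocks.\<close>
  have h_d_any: "\<exists>z\<in>B 0. y = (h ^^ block y) z \<and> (h ^^ d) y = (h ^^ block y) (w z)" if y: "y \<in> S" for y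
  proof -
    have perm: "(h ^^ block y) permutes S" using permutes[OF funpow_closed[OF hH]] .
    obtain z where z: "y = (h ^^ block y) z" using perm by (metis permutes_surj surjD)
    then have "(h ^^ block y) z \<in> S" using y by simp
    then have zS: "z \<in> S" using perm by (simp add: permutes_in_image)
    have "(block z + block y) mod d = block y mod d"
      using shift_pow[OF zS, of "block y"] z block_less[of y] by simp
    then have "block z = 0"
      using block_less[of z] block_less[of y] by (cases "block z + block y < d") (auto simp: mod_if split: if_splits)
    then have z0: "z \<in> B 0" using zS by (simp add: B_def)
    have "(h ^^ d) ((h ^^ block y) z) = (h ^^ block y) ((h ^^ d) z)"
      by (metis add.commute funpow_add o_apply)
    then show ?thesis using z z0 h_d[OF z0] by metis
  qed
  have h_out: "(h ^^ k) y = y" if "y \<notin> S" for k y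
    using permutes[OF funpow_closed[OF hH]] that by (rule permutes_not_in)
  have K: "h ^^ K = id"
  proof (cases "even (card (B 0))")
    case True
    have "(h ^^ (d + d)) y = y" for y
    proof (cases "y \<in> S")
      case True
      obtain z where z: "z \<in> B 0" "y = (h ^^ block y) z" "(h ^^ d) y = (h ^^ block y) (w z)"
        using h_d_any[OF True] by blast
      have "w z \<in> B 0" using z(1) w(1) by (simp add: permutes_in_image)
      have "(h ^^ (d + d)) y = (h ^^ d) ((h ^^ block y) (w z))" using z(3) by (simp only: funpow_add o_apply)
      also have "\<dots> = (h ^^ block y) ((h ^^ d) (w z))" by (metis add.commute funpow_add o_apply)
      also have "\<dots> = (h ^^ block y) (w (w z))" using h_d[OF \<open>w z \<in> B 0\<close>] by simp
      also have "w (w z) = z" using w(2) by (metis id_apply o_apply)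
      finally show ?thesis using z(2) by simp
    qed (rule h_out)
    then show ?thesis using True by (simp add: K_def fun_eq_iff mult_2)
  next
    case False
    then have "w = id" using w(4) evenperm_return by simp
    have "(h ^^ d) y = y" for y
    proof (cases "y \<in> S")
      case True
      then show ?thesis using h_d_any[OF True] \<open>w = id\<close> by (metis id_apply)
    qed (rule h_out)
    then show ?thesis using False by (simp add: K_def fun_eq_iff)
  qed
  \<comment> \<open>\<open>h\<close> shifts the blocks cyclically, so \<open>d\<close> divides
    \<open>j\<close>. Below \<open>2 * d\<close> this leaves only \<open>j = d\<close>, where the
    restriction to \<open>B 0\<close> is the odd \<open>w\<close>; below \<open>d\<close> it leaves
    nothing.\<close>
  have notN: "h ^^ j \<notin> block_alt" if j: "0 < j" "j < K" for j
  proof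
    assume block_alt: "h ^^ j \<in> block_alt"
    obtain x where x: "x \<in> P" using card_P by fastforce
    then have xS: "x \<in> S" using P_subset by blast
    then have "block ((h ^^ j) x) = block x" using block_alt by (simp add: block_alt_def)
    then have "d dvd j" using shift_pow[OF xS, of j] block_P[OF x] by auto
    then obtain i where i: "j = d * i" by (rule dvdE)
    show False
    proof (cases "even (card (B 0))")
      case True
      then have "d * i < d * 2" using i j by (simp add: K_def mult.commute)
      then have "i = 1" using i j(1) by (cases i) auto
      then have "perm_restrict (h ^^ j) (B 0) = w"
        using i h_d w(1) by (auto simp: perm_restrict_def fun_eq_iff dest: permutes_not_in)
      then have "evenperm w" using block_alt_evenperm[OF block_alt d_pos] by simp
      then show False using True w(3) evenperm_return by simp
    next
      case False
      then show False using i j d_pos by (auto simp: K_def)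
    qed
  qed
  show ?thesis using hH K notN shift qN h_def by blast
qed

end

text \<open>Generation is phrased as minimality, the form in which \<open>complement\<close> uses
  it: \<open>H\<close> lies in every permutation group that contains both rotations.\<close>

locale five_star_generated = five_star_group +
  assumes generated: "permutation_group M S \<Longrightarrow> a \<in> M \<Longrightarrow> b \<in> M \<Longrightarrow> H \<subseteq> M"
begin

lemma complement:
  defines "K \<equiv> if even (card (B 0)) then 2 * d else d"
  obtains h where "h \<in> H" "h ^^ K = id" "\<And>j. 0 < j \<Longrightarrow> j < K \<Longrightarrow> h ^^ j \<notin> block_alt"
    "\<And>g k. g \<in> block_alt \<Longrightarrow> h ^^ k \<circ> g \<circ> inv' (h ^^ k) \<in> block_alt"
    "\<And>g. g \<in> H \<Longrightarrow> \<exists>x\<in>block_alt. \<exists>k. g = x \<circ> h ^^ k"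
proof -
  obtain h g0 where h: "h \<in> H" "h ^^ K = id" "\<And>j. 0 < j \<Longrightarrow> j < K \<Longrightarrow> h ^^ j \<notin> block_alt"
      "\<And>y. y \<in> S \<Longrightarrow> block (h y) = Suc (block y) mod d" and g0: "g0 \<in> block_alt" "h = a \<circ> g0"
    using ex_complement unfolding K_def by blast
  have K_pos: "0 < K" using d_pos by (simp add: K_def)
  have bh: "bij (h ^^ k)" for k using bij funpow_closed[OF h(1)] by blast
  have conj: "h ^^ k \<circ> g \<circ> inv' (h ^^ k) \<in> block_alt" if "g \<in> block_alt" for g k
  proof (induction k)
    case (Suc k)
    have "h ^^ Suc k \<circ> g \<circ> inv' (h ^^ Suc k) = h \<circ> (h ^^ k \<circ> g \<circ> inv' (h ^^ k)) \<circ> inv' h"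
      using bij[OF h(1)] bh[of k] by (simp add: o_inv_distrib o_assoc)
    then show ?case using block_alt_conj[OF permutes[OF h(1)] h(4) Suc] by metis
  qed (use that in \<open>simp add: inv_id\<close>)
  have conj_eq: "h ^^ k \<circ> g = (h ^^ k \<circ> g \<circ> inv' (h ^^ k)) \<circ> h ^^ k" for k g
    using bh[of k] by (auto simp: fun_eq_iff bij_def)
  \<comment> \<open>These products form a group because \<open>h\<close> normalizes
    \<open>block_alt\<close>. It contains \<open>b\<close>, and also \<open>a\<close>, which differs
    from \<open>h\<close> by an element of \<open>block_alt\<close>; hence it contains
    \<open>H\<close>.\<close>
  define M where "M = {x \<circ> h ^^ k | x k. x \<in> block_alt}"
  have "permutation_group M S"
  proof
    show "finite S" by (rule finite_S)
    show "id \<in> M" unfolding M_def using block_alt_id by (intro CollectI exI[of _ id] exI[of _ 0]) simp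
  next
    fix g assume "g \<in> M"
    then obtain x k where x: "x \<in> block_alt" "g = x \<circ> h ^^ k" by (auto simp: M_def)
    then show "g permutes S"
      using block_alt_closed funpow_closed[OF h(1)] comp_closed permutes by blast
    \<comment> \<open>Since \<open>h ^^ K = id\<close>, inverses of powers of \<open>h\<close> are
      again natural powers.\<close>
    have "h ^^ ((K - 1) * k) \<circ> h ^^ k = (h ^^ K) ^^ k"
      using K_pos by (simp add: funpow_mult flip: funpow_add mult_Suc)
        (metis One_nat_def Suc_pred add.commute mult_Suc)
    then have inv_h: "inv' (h ^^ k) = h ^^ ((K - 1) * k)"
      using h(2) by (intro inv_unique_comp) (auto simp: id_funpow, metis add.commute funpow_add)
    have "inv' g = h ^^ ((K - 1) * k) \<circ> inv' x"
      unfolding x(2) inv_h[symmetric]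
      using x(1) block_alt_closed bij bh[of k] by (intro o_inv_distrib) auto
    also note conj_eq
    finally show "inv' g \<in> M"
      unfolding M_def using conj[OF block_alt_inv[OF x(1)]] by blast
    fix g' assume "g' \<in> M"
    then obtain x' k' where x': "x' \<in> block_alt" "g' = x' \<circ> h ^^ k'" by (auto simp: M_def)
    have "g \<circ> g' = x \<circ> (h ^^ k \<circ> x') \<circ> h ^^ k'"
      unfolding x x' by (simp add: o_assoc)
    also have "\<dots> = (x \<circ> (h ^^ k \<circ> x' \<circ> inv' (h ^^ k))) \<circ> h ^^ (k + k')"
      by (subst conj_eq) (simp add: funpow_add o_assoc)
    finally show "g \<circ> g' \<in> M"
      unfolding M_def using block_alt_comp[OF x(1) conj[OF x'(1), of k]] by blast
  qed
  moreover have "a \<in> M"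
  proof -
    have "a = h \<circ> inv' g0"
      using g0 block_alt_closed bij by (auto simp: fun_eq_iff bij_def surj_f_inv_f)
    also have "\<dots> = (h ^^ 1 \<circ> inv' g0 \<circ> inv' (h ^^ 1)) \<circ> h ^^ 1"
      using conj_eq[of 1 "inv' g0"] by simp
    finally show ?thesis unfolding M_def using conj[OF block_alt_inv[OF g0(1)], of 1] by blast
  qed
  moreover have "b \<in> M"
    unfolding M_def using b_in_block_alt by (intro CollectI exI[of _ b] exI[of _ 0]) simp
  ultimately have "H \<subseteq> M" by (rule generated)
  then show thesis using that[of h] h conj unfolding M_def by blast
qed

end

section \<open>The isomorphism\<close>

context five_star_group begin

abbreviation block_size :: nat where "block_size \<equiv> card (B 0)"

lemma card_B:
  assumes "i < d"
  shows "card (B i) = block_size"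
proof -
  have "inj_on (a ^^ i) (B 0)"
    using bij_funpow_a[of i] by (auto simp: bij_def intro: inj_on_subset)
  then show ?thesis using card_image funpow_a_image_B[OF assms] by metis
qed

text \<open>The enumerations of different blocks are chosen independently: the complement acts by
  whatever conjugation induces, and the semidirect product asks only for some action.\<close>

definition enum_block :: "nat \<Rightarrow> nat \<Rightarrow> 'a" where
  "enum_block i = (SOME f. bij_betw f {1..block_size} (B i))"

lemma enum_block_bij:
  assumes "i < d"
  shows "bij_betw (enum_block i) {1..block_size} (B i)"
proof -
  have "card {1..block_size} = card (B i)" using card_B[OF assms] by simp
  then have "\<exists>f. bij_betw f {1..block_size} (B i)"
    by (rule finite_same_card_bij[OF finite_atLeastAtMost finite_B])
  then show ?thesis unfolding enum_block_def by (rule someI_ex)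
qed

definition on_block :: "nat \<Rightarrow> (nat \<Rightarrow> nat) \<Rightarrow> 'a \<Rightarrow> 'a" where
  "on_block i = map_permutation {1..block_size} (enum_block i)"

lemma on_block_permutes: "i < d \<Longrightarrow> p permutes {1..block_size} \<Longrightarrow> on_block i p permutes B i"
  unfolding on_block_def by (rule map_permutation_permutes[OF enum_block_bij])

lemma on_block_evenperm: "i < d \<Longrightarrow> p permutes {1..block_size} \<Longrightarrow> evenperm (on_block i p) \<longleftrightarrow> evenperm p"
  unfolding on_block_def using enum_block_bij[of i] by (intro evenperm_map_permutation) (auto simp: bij_betw_def)

lemma on_block_apply: "i < d \<Longrightarrow> k \<in> {1..block_size} \<Longrightarrow> on_block i p (enum_block i k) = enum_block i (p k)"
  using enum_block_bij[of i] by (auto simp: on_block_def map_permutation_def restrict_id_def bij_betw_def)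

lemma B_cases:
  assumes "i < d" "y \<in> B i"
  obtains k where "k \<in> {1..block_size}" "y = enum_block i k"
proof -
  have "enum_block i ` {1..block_size} = B i" using enum_block_bij[OF assms(1)] by (simp only: bij_betw_def)
  then show thesis using that assms(2) by blast
qed

lemma enum_block_eq_iff: "i < d \<Longrightarrow> j \<in> {1..block_size} \<Longrightarrow> k \<in> {1..block_size} \<Longrightarrow> enum_block i j = enum_block i k \<longleftrightarrow> j = k"
  using enum_block_bij[of i] by (auto simp: bij_betw_def inj_on_eq_iff)

lemma on_block_comp:
  assumes "i < d" "p permutes {1..block_size}" "q permutes {1..block_size}"
  shows "on_block i (p \<circ> q) = on_block i p \<circ> on_block i q"
proof
  fix y
  show "on_block i (p \<circ> q) y = (on_block i p \<circ> on_block i q) y"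
  proof (cases "y \<in> B i")
    case True
    then obtain k where k: "k \<in> {1..block_size}" "y = enum_block i k" using B_cases[OF assms(1)] by blast
    then have "q k \<in> {1..block_size}" using assms(3) by (simp only: permutes_in_image)
    then show ?thesis using k assms(1) by (simp only: on_block_apply o_apply)
  next
    case False
    then show ?thesis
      using on_block_permutes[OF assms(1,2)] on_block_permutes[OF assms(1,3)]
        on_block_permutes[OF assms(1) permutes_compose[OF assms(3,2)]]
      by (simp add: permutes_not_in)
  qed
qed

lemma on_block_inject:
  assumes "i < d" "p permutes {1..block_size}" "q permutes {1..block_size}" "on_block i p = on_block i q"
  shows "p = q"
proof
  fix k
  show "p k = q k"
  proof (cases "k \<in> {1..block_size}")
    case True
    then have "p k \<in> {1..block_size}" "q k \<in> {1..block_size}" using assms(2,3) by (simp_all only: permutes_in_image)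
    moreover have "enum_block i (p k) = enum_block i (q k)"
      using on_block_apply[OF assms(1) True, of p] on_block_apply[OF assms(1) True, of q] assms(4) by simp
    ultimately show ?thesis using enum_block_eq_iff[OF assms(1)] by blast
  qed (use assms in \<open>simp add: permutes_not_in\<close>)
qed

lemma on_block_surj:
  assumes i: "i < d" and p: "p permutes B i"
  obtains q where "q permutes {1..block_size}" "on_block i q = p"
proof -
  define q where "q = map_permutation (B i) (inv_into {1..block_size} (enum_block i)) p"
  have q: "q permutes {1..block_size}"
    unfolding q_def by (rule map_permutation_permutes[OF bij_betw_inv_into[OF enum_block_bij[OF i]] p])
  moreover have "on_block i q = p"
    unfolding on_block_def q_def
    by (rule map_permutation_compose_inv[OF bij_betw_inv_into[OF enum_block_bij[OF i]] p])
       (use enum_block_bij[OF i] in \<open>auto simp: bij_betw_inv_into_right\<close>)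
  ultimately show thesis by (rule that)
qed

definition embed :: "(nat \<Rightarrow> nat \<Rightarrow> nat) \<Rightarrow> 'a \<Rightarrow> 'a" where
  "embed f y = (if y \<in> S then on_block (block y) (f (block y)) y else y)"

lemma alt_group_power_carrier:
  "f \<in> carrier (alt_group_power block_size d) \<longleftrightarrow>
     f \<in> extensional {..<d} \<and> (\<forall>i<d. f i permutes {1..block_size} \<and> evenperm (f i))"
  by (auto simp: PiE_iff alt_group_carrier)

lemma embed_restrict:
  assumes "i < d" "f i permutes {1..block_size}"
  shows "perm_restrict (embed f) (B i) = on_block i (f i)"
  using permutes_not_in[OF on_block_permutes[OF assms]]
  by (auto simp: perm_restrict_def embed_def B_def fun_eq_iff)

lemma embed_in_block_alt:
  assumes f: "f \<in> carrier (alt_group_power block_size d)"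
  shows "embed f \<in> block_alt"
proof -
  have fi: "f i permutes {1..block_size}" "evenperm (f i)" if "i < d" for i
    using f that by (auto simp only: alt_group_power_carrier)
  have in_B: "embed f y \<in> B (block y)" if y: "y \<in> S" for y
  proof -
    have "y \<in> B (block y)" using y by (simp add: B_def)
    then show ?thesis
      using permutes_in_image[OF on_block_permutes[OF block_less fi(1)[OF block_less]], of y y y] y
      by (simp add: embed_def)
  qed
  have blk: "block (embed f y) = block y" if "y \<in> S" for y
    using in_B[OF that] by (simp add: B_def)
  have "embed f permutes S"
  proof (rule bij_imp_permutes)
    have "inj_on (embed f) S"
    proof (rule inj_onI)
      fix x y assume xy: "x \<in> S" "y \<in> S" "embed f x = embed f y"
      then have "block x = block y" using blk by metis
      then have "on_block (block x) (f (block x)) x = on_block (block x) (f (block x)) y"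
        using xy by (simp add: embed_def)
      then show "x = y"
        using permutes_inj[OF on_block_permutes[OF block_less fi(1)[OF block_less]]] by (simp add: inj_eq)
    qed
    moreover have "embed f ` S \<subseteq> S" using in_B B_subset by blast
    ultimately show "bij_betw (embed f) S S"
      using endo_inj_surj[OF finite_S] by (simp add: bij_betw_def)
  qed (simp add: embed_def)
  moreover have "evenperm (perm_restrict (embed f) (B i))" if "i < d" for i
    using embed_restrict[of i f, OF that fi(1)[OF that]] on_block_evenperm[OF that fi(1)[OF that]] fi(2)[OF that]
    by simp
  ultimately show ?thesis using blk by (simp add: block_alt_def)
qed

lemma embed_mult:
  assumes f: "f \<in> carrier (alt_group_power block_size d)" and g: "g \<in> carrier (alt_group_power block_size d)"
  shows "embed (f \<otimes>\<^bsub>alt_group_power block_size d\<^esub> g) = embed f \<circ> embed g"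
proof
  fix y
  show "embed (f \<otimes>\<^bsub>alt_group_power block_size d\<^esub> g) y = (embed f \<circ> embed g) y"
  proof (cases "y \<in> S")
    case True
    have "embed g y \<in> S" "block (embed g y) = block y"
      using embed_in_block_alt[OF g] True by (auto simp: block_alt_def permutes_in_image)
    moreover have "f i permutes {1..block_size}" "g i permutes {1..block_size}" if "i < d" for i
      using f g that by (auto simp only: alt_group_power_carrier)
    from on_block_comp[OF block_less this(1)[OF block_less] this(2)[OF block_less]]
    have "on_block (block y) (f (block y) \<circ> g (block y)) =
        on_block (block y) (f (block y)) \<circ> on_block (block y) (g (block y))" .
    moreover have "embed g y = on_block (block y) (g (block y)) y"
      using True by (simp add: embed_def)
    ultimately show ?thesis
      using True block_less[of y] by (simp add: embed_def[of f] embed_def[of "restrict _ _"] alt_group_mult)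
  qed (simp add: embed_def)
qed

lemma embed_inj: "inj_on embed (carrier (alt_group_power block_size d))"
proof (rule inj_onI)
  fix f g assume f: "f \<in> carrier (alt_group_power block_size d)" and g: "g \<in> carrier (alt_group_power block_size d)"
    and eq: "embed f = embed g"
  have fg: "f i permutes {1..block_size}" "g i permutes {1..block_size}" if "i < d" for i
    using f g that by (auto simp only: alt_group_power_carrier)
  have "f i = g i" if i: "i < d" for i
    using on_block_inject[OF i fg[OF i]] embed_restrict[of i f] embed_restrict[of i g] i fg[OF i] eq by simp
  then show "f = g"
    using f g unfolding alt_group_power_carrier by (auto intro: extensionalityI[where A = "{..<d}"])
qed

lemma embed_image: "embed ` carrier (alt_group_power block_size d) = block_alt"
proof
  show "block_alt \<subseteq> embed ` carrier (alt_group_power block_size d)"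
  proof
    fix g assume g: "g \<in> block_alt"
    have "\<exists>q. q permutes {1..block_size} \<and> on_block i q = perm_restrict g (B i)" if "i < d" for i
      using on_block_surj[OF that block_alt_restrict_permutes[OF g]] by metis
    then obtain q where q: "\<And>i. i < d \<Longrightarrow> q i permutes {1..block_size} \<and> on_block i (q i) = perm_restrict g (B i)"
      by metis
    define f where "f = restrict q {..<d}"
    have "f \<in> carrier (alt_group_power block_size d)"
      unfolding alt_group_power_carrier
    proof (intro conjI allI impI)
      fix i assume i: "i < d"
      show "f i permutes {1..block_size}" using q i by (simp add: f_def)
      show "evenperm (f i)"
        using q[OF i] on_block_evenperm[OF i, of "q i"] block_alt_evenperm[OF g i] i by (simp add: f_def)
    qed (simp add: f_def)
    moreover have "embed f = g"
    proof
      fix y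
      show "embed f y = g y"
      proof (cases "y \<in> S")
        case True
        have "embed f y = perm_restrict g (B (block y)) y"
          using True q[OF block_less, of y] block_less[of y] by (simp add: embed_def f_def)
        then show ?thesis using True by (simp add: perm_restrict_def B_def)
      next
        case False
        moreover have "g permutes S" using g by (simp add: block_alt_def)
        ultimately show ?thesis by (simp add: embed_def permutes_not_in)
      qed
    qed
    ultimately show "g \<in> embed ` carrier (alt_group_power block_size d)" by blast
  qed
qed (use embed_in_block_alt in blast)

end

text \<open>\<open>embed\<close> supplies the normal factor and the powers of the corrected rotation
  \<open>h\<close> the cyclic one. \<open>G\<close> is specified by its operations, so the record
  produced by \<open>subgroup_generated\<close> fits.\<close>

lemma (in five_star_generated) iso_to_semidirect_product:
  fixes G :: "('a \<Rightarrow> 'a) monoid"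
  assumes G: "group G" and carrier: "carrier G = H" and mult: "\<And>x y. x \<otimes>\<^bsub>G\<^esub> y = x \<circ> y"
    and one: "\<one>\<^bsub>G\<^esub> = id"
  shows "iso_to_semidirect_product G (alt_group_power block_size d)
           (integer_mod_group (if even block_size then 2 * d else d))"
proof -
  define K where "K = (if even block_size then 2 * d else d)"
  have K_pos: "0 < K" using d_pos by (simp add: K_def)
  obtain h where h: "h \<in> H" "h ^^ K = id" "\<And>j. 0 < j \<Longrightarrow> j < K \<Longrightarrow> h ^^ j \<notin> block_alt"
    "\<And>g k. g \<in> block_alt \<Longrightarrow> h ^^ k \<circ> g \<circ> inv' (h ^^ k) \<in> block_alt"
    "\<And>g. g \<in> H \<Longrightarrow> \<exists>x\<in>block_alt. \<exists>k. g = x \<circ> h ^^ k"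
    using complement unfolding K_def by blast
  have h_mod: "h ^^ (k mod K) = h ^^ k" for k
  proof
    fix x
    show "(h ^^ (k mod K)) x = (h ^^ k) x" by (rule funpow_mod_eq) (simp add: h(2))
  qed
  have inv_G: "inv\<^bsub>G\<^esub> x = inv' x" if "x \<in> H" for x
  proof (rule group.inv_equality[OF G])
    show "inv' x \<otimes>\<^bsub>G\<^esub> x = \<one>\<^bsub>G\<^esub>"
      using bij[OF that] by (simp add: mult one bij_is_inj)
  qed (use that inv_closed in \<open>simp_all add: carrier\<close>)
  \<comment> \<open>Positivity of \<open>K\<close> matters: \<open>integer_mod_group 0\<close> is
    the group of all integers. Residues are integers, hence the conversions by \<open>nat\<close>
    below.\<close>
  have car: "carrier (integer_mod_group K) = {0..<int K}"
    using K_pos by (simp add: carrier_integer_mod_group)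
  have "iso_to_semidirect_product G (alt_group_power block_size d) (integer_mod_group K)"
  proof (rule iso_to_semidirect_productI[where \<psi> = embed and \<chi> = "\<lambda>j. h ^^ nat j"])
    show "group G" by fact
    show "group (alt_group_power block_size d)" by (intro product_group alt_group_is_group)
    show "group (integer_mod_group K)" by (rule group_integer_mod_group)
    show "inj_on embed (carrier (alt_group_power block_size d))" by (rule embed_inj)
    show "embed \<in> hom (alt_group_power block_size d) G"
      using embed_in_block_alt block_alt_closed by (intro homI) (auto simp only: carrier mult embed_mult)
    show "(\<lambda>j. h ^^ nat j) \<in> hom (integer_mod_group K) G"
    proof (rule homI)
      fix i j assume "i \<in> carrier (integer_mod_group K)" "j \<in> carrier (integer_mod_group K)"
      then have "nat (i \<otimes>\<^bsub>integer_mod_group K\<^esub> j) = (nat i + nat j) mod K"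
        unfolding car by (simp add: nat_mod_distrib nat_add_distrib)
      then show "h ^^ nat (i \<otimes>\<^bsub>integer_mod_group K\<^esub> j) = h ^^ nat i \<otimes>\<^bsub>G\<^esub> h ^^ nat j"
        by (simp only: h_mod funpow_add mult)
    qed (simp add: carrier funpow_closed h(1))
    show "h ^^ nat c \<otimes>\<^bsub>G\<^esub> embed x \<otimes>\<^bsub>G\<^esub> inv\<^bsub>G\<^esub> (h ^^ nat c) \<in> embed ` carrier (alt_group_power block_size d)"
      if "x \<in> carrier (alt_group_power block_size d)" for c x
      using h(4)[OF embed_in_block_alt[OF that]] unfolding embed_image
      by (simp only: mult inv_G[OF funpow_closed[OF h(1)]])
    show "c = \<one>\<^bsub>integer_mod_group K\<^esub>"
      if "c \<in> carrier (integer_mod_group K)" "h ^^ nat c \<in> embed ` carrier (alt_group_power block_size d)" for c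
      using that h(3)[of "nat c"] unfolding car embed_image by (cases "c = 0") (auto simp: nat_less_iff)
    show "\<exists>x\<in>carrier (alt_group_power block_size d). \<exists>c\<in>carrier (integer_mod_group K). g = embed x \<otimes>\<^bsub>G\<^esub> h ^^ nat c"
      if g: "g \<in> carrier G" for g
    proof -
      obtain x k where x: "x \<in> block_alt" "g = x \<circ> h ^^ k" using h(5) g carrier by blast
      obtain f where f: "f \<in> carrier (alt_group_power block_size d)" "x = embed f"
        using x(1) embed_image by blast
      have "int (k mod K) \<in> carrier (integer_mod_group K)" using K_pos by (simp add: car)
      moreover have "g = embed f \<otimes>\<^bsub>G\<^esub> h ^^ nat (int (k mod K))"
        using x f by (simp only: mult h_mod nat_int)
      ultimately show ?thesis using f(1) by blast
    qed
  qed
  then show ?thesis by (simp only: K_def)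
qed

section \<open>The monodromy group of the tree\<close>

lemma size_filter_image_mset_set:
  "finite A \<Longrightarrow> size {#y \<in># image_mset f (mset_set A). Q y#} = card {x \<in> A. Q (f x)}"
  by (simp add: filter_mset_image_mset)

context
  fixes T :: "('b, 'w) bicolored_map" and r s n :: nat
  assumes tree: "bicolored_plane_tree T" and r_neq_s: "r \<noteq> s"
    and passport: "passport T =
      (replicate_mset 3 r + replicate_mset 2 s, {#5#} + replicate_mset (n - 5) 1, n)"
begin

lemma rot_black_permutes: "rot_black T permutes edges T"
  and rot_white_permutes: "rot_white T permutes edges T"
  and finite_blacks: "finite (blacks T)" and finite_whites: "finite (whites T)"
  and edges_subset: "edges T \<subseteq> blacks T \<times> whites T"
  and rot_black_cyclic: "x \<in> edges T \<Longrightarrow> cyclic_on (rot_black T) (black_star T (fst x))"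
  and rot_white_cyclic: "x \<in> edges T \<Longrightarrow> cyclic_on (rot_white T) (white_star T (snd x))"
  using tree by (auto simp: bicolored_plane_tree_def)

lemma finite_edges: "finite (edges T)"
  using finite_subset[OF edges_subset] finite_blacks finite_whites by blast

lemma card_edges: "card (edges T) = n"
  and black_degrees: "image_mset (\<lambda>b. card (black_star T b)) (mset_set (blacks T)) =
    replicate_mset 3 r + replicate_mset 2 s"
  and white_degrees: "image_mset (\<lambda>w. card (white_star T w)) (mset_set (whites T)) =
    {#5#} + replicate_mset (n - 5) 1"
  using passport by (auto simp: passport_def)

lemma card_blacks: "card (blacks T) = 5"
  using arg_cong[OF black_degrees, of size] by simp

lemma black_degree: "b \<in> blacks T \<Longrightarrow> card (black_star T b) = r \<or> card (black_star T b) = s"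
  using arg_cong[OF black_degrees, of set_mset] finite_blacks by (auto split: if_splits)

lemma card_blacks_r: "card {b \<in> blacks T. card (black_star T b) = r} = 3"
proof -
  have "card {b \<in> blacks T. card (black_star T b) = r} =
      size {#k \<in># replicate_mset 3 r + replicate_mset 2 s. k = r#}"
    unfolding black_degrees[symmetric] by (simp add: size_filter_image_mset_set finite_blacks)
  also have "\<dots> = 3" using r_neq_s by (simp add: numeral_eq_Suc)
  finally show ?thesis .
qed

lemma ex_white_center:
  "\<exists>w\<in>whites T. card (white_star T w) = 5 \<and> (\<forall>v\<in>whites T - {w}. card (white_star T v) = 1)"
proof -
  have "5 \<in># image_mset (\<lambda>w. card (white_star T w)) (mset_set (whites T))"
    unfolding white_degrees by simp
  then obtain w where w: "w \<in> whites T" "card (white_star T w) = 5"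
    using finite_whites by auto
  have "mset_set (whites T) = add_mset w (mset_set (whites T - {w}))"
    using w(1) finite_whites by (simp add: mset_set.remove)
  then have "image_mset (\<lambda>w. card (white_star T w)) (mset_set (whites T - {w})) = replicate_mset (n - 5) 1"
    using white_degrees w(2) by simp
  from arg_cong[OF this, of set_mset] have "(\<lambda>w. card (white_star T w)) ` (whites T - {w}) \<subseteq> {1}"
    using finite_whites by (auto split: if_splits)
  then show ?thesis using w by blast
qed

text \<open>Edges are pairs, so the five edges at the central white vertex have distinct black ends.
  There are only five black vertices, so each is met exactly once: these edges form a transversal of
  the black cycles, and their periods are the black degrees.\<close>

lemma edge_center:
  obtains P where "P \<subseteq> edges T" "card P = 5" "cyclic_on (rot_white T) P"
    "\<And>x. x \<notin> P \<Longrightarrow> rot_white T x = x"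
    "\<And>x. x \<in> edges T \<Longrightarrow> \<exists>y\<in>P. x \<in> orbit (rot_black T) y"
    "\<And>x y. x \<in> P \<Longrightarrow> y \<in> P \<Longrightarrow> y \<in> orbit (rot_black T) x \<Longrightarrow> x = y"
    "\<And>x. x \<in> P \<Longrightarrow> least_power (rot_black T) x = r \<or> least_power (rot_black T) x = s"
    "card {x \<in> P. least_power (rot_black T) x = r} = 3"
proof -
  obtain w where w: "w \<in> whites T" "card (white_star T w) = 5"
    and leaves: "\<And>v. v \<in> whites T \<Longrightarrow> v \<noteq> w \<Longrightarrow> card (white_star T v) = 1"
    using ex_white_center by auto
  define P where "P = white_star T w"
  have P_edges: "P \<subseteq> edges T" by (auto simp: P_def white_star_def)
  have "card P = 5" using w by (simp add: P_def)
  then obtain x0 where x0: "x0 \<in> P" by (metis card.empty equals0I zero_neq_numeral)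
  have "cyclic_on (rot_white T) P"
    using rot_white_cyclic[of x0] x0 P_edges by (auto simp: P_def white_star_def)
  \<comment> \<open>The white end of such an edge is a leaf, and a cyclic rotation of a single edge
    is trivial.\<close>
  have fixes_outside: "rot_white T x = x" if "x \<notin> P" for x
  proof (cases "x \<in> edges T")
    case True
    then have "card (white_star T (snd x)) = 1"
      using that edges_subset leaves[of "snd x"] by (auto simp: P_def white_star_def)
    moreover have "x \<in> white_star T (snd x)" using True by (simp add: white_star_def)
    ultimately have "white_star T (snd x) = {x}" by (metis card_1_singletonE singletonD)
    then show ?thesis
      using rot_white_cyclic[OF True] cyclic_on_inI[of "rot_white T" "{x}" x] by simp
  qed (use rot_white_permutes in \<open>simp add: permutes_not_in\<close>)
  have fst_inj: "inj_on fst P" by (auto simp: inj_on_def P_def white_star_def prod_eq_iff)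
  have "fst ` P \<subseteq> blacks T" using P_edges edges_subset by auto
  then have fst_P: "fst ` P = blacks T"
    using card_subset_eq[OF finite_blacks] card_image[OF fst_inj] card_blacks \<open>card P = 5\<close> by simp
  have orb: "orbit (rot_black T) x = black_star T (fst x)" if "x \<in> edges T" for x
    using orbit_cyclic_eq3[OF rot_black_cyclic[OF that]] that by (simp add: black_star_def)
  have perm: "permutation (rot_black T)"
    using rot_black_permutes finite_edges by (auto simp: permutation_permutes)
  have lp: "least_power (rot_black T) x = card (black_star T (fst x))" if "x \<in> edges T" for x
    using card_cyclic_on[OF perm rot_black_cyclic[OF that], of x] that by (simp add: black_star_def)
  have cover: "\<exists>y\<in>P. x \<in> orbit (rot_black T) y" if x: "x \<in> edges T" for x
  proof -
    have "fst x \<in> fst ` P" using fst_P x edges_subset by auto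
    then obtain y where y: "y \<in> P" "fst y = fst x" by auto
    then have "x \<in> black_star T (fst y)" using x by (simp add: black_star_def)
    then show ?thesis using y P_edges orb[of y] by auto
  qed
  have sep: "x = y" if "x \<in> P" "y \<in> P" "y \<in> orbit (rot_black T) x" for x y
  proof -
    have "fst y = fst x" using that P_edges orb[of x] by (auto simp: black_star_def)
    then show ?thesis using fst_inj that by (auto dest: inj_onD)
  qed
  have "fst ` {x \<in> P. least_power (rot_black T) x = r} = {b \<in> blacks T. card (black_star T b) = r}"
    using fst_P P_edges lp by (auto simp: image_iff subset_iff) force+
  then have card_r: "card {x \<in> P. least_power (rot_black T) x = r} = 3"
    using card_image[of fst "{x \<in> P. least_power (rot_black T) x = r}"] fst_inj card_blacks_r
    by (metis (no_types, lifting) inj_on_subset mem_Collect_eq subsetI)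
  have period: "least_power (rot_black T) x = r \<or> least_power (rot_black T) x = s" if "x \<in> P" for x
    using that P_edges lp[of x] black_degree[of "fst x"] fst_P by auto
  show thesis
    by (rule that[OF P_edges \<open>card P = 5\<close> \<open>cyclic_on (rot_white T) P\<close> fixes_outside cover sep period card_r])
qed

end

section \<open>Transport of an edge permutation along a labelling\<close>

context
  fixes T :: "('b, 'w) bicolored_map" and l :: "nat \<Rightarrow> 'b \<times> 'w" and \<rho> :: "'b \<times> 'w \<Rightarrow> 'b \<times> 'w"
  assumes labelling: "edge_labelling T l" and permutes_edges: "\<rho> permutes edges T"
begin

lemma l_bij: "bij_betw l {1..card (edges T)} (edges T)"
  using labelling by (simp add: edge_labelling_def)

text \<open>\<open>l\<close> intertwines the labelled permutation with \<open>\<rho>\<close>;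
  powers, orbits and periods are transferred through this relation.\<close>

lemma labelled_perm_apply:
  "x \<in> {1..card (edges T)} \<Longrightarrow> labelled_perm T l \<rho> x \<in> {1..card (edges T)} \<and> l (labelled_perm T l \<rho> x) = \<rho> (l x)"
proof -
  assume x: "x \<in> {1..card (edges T)}"
  then have "l x \<in> edges T" using l_bij by (auto simp: bij_betw_def)
  then have "\<rho> (l x) \<in> l ` {1..card (edges T)}"
    using l_bij permutes_edges by (simp add: bij_betw_def permutes_in_image)
  then show ?thesis
    using x inv_into_into[of "\<rho> (l x)" l "{1..card (edges T)}"]
    by (simp add: labelled_perm_def Let_def perm_restrict_def f_inv_into_f)
qed

lemma labelled_perm_fixes: "x \<notin> {1..card (edges T)} \<Longrightarrow> labelled_perm T l \<rho> x = x"
  by (auto simp: labelled_perm_def Let_def perm_restrict_def)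

lemma l_eq_iff: "x \<in> {1..card (edges T)} \<Longrightarrow> y \<in> {1..card (edges T)} \<Longrightarrow> l x = l y \<longleftrightarrow> x = y"
  using l_bij by (auto simp: bij_betw_def inj_on_eq_iff)

lemma labelled_perm_permutes: "labelled_perm T l \<rho> permutes {1..card (edges T)}"
proof (rule bij_imp_permutes)
  have "inj_on (labelled_perm T l \<rho>) {1..card (edges T)}"
  proof (rule inj_onI)
    fix x y assume xy: "x \<in> {1..card (edges T)}" "y \<in> {1..card (edges T)}"
      "labelled_perm T l \<rho> x = labelled_perm T l \<rho> y"
    then have "\<rho> (l x) = \<rho> (l y)" using labelled_perm_apply by metis
    then have "l x = l y" using permutes_inj[OF permutes_edges] by (simp add: inj_eq)
    then show "x = y" using xy l_eq_iff by blast
  qed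
  moreover have "labelled_perm T l \<rho> ` {1..card (edges T)} \<subseteq> {1..card (edges T)}"
    using labelled_perm_apply by blast
  ultimately show "bij_betw (labelled_perm T l \<rho>) {1..card (edges T)} {1..card (edges T)}"
    using endo_inj_surj[of "{1..card (edges T)}"] by (simp add: bij_betw_def)
qed (rule labelled_perm_fixes)

lemma labelled_perm_funpow:
  "x \<in> {1..card (edges T)} \<Longrightarrow>
     (labelled_perm T l \<rho> ^^ k) x \<in> {1..card (edges T)} \<and> l ((labelled_perm T l \<rho> ^^ k) x) = (\<rho> ^^ k) (l x)"
proof (induction k)
  case (Suc k)
  then show ?case using labelled_perm_apply[of "(labelled_perm T l \<rho> ^^ k) x"] by simp
qed simp

lemma labelled_perm_funpow_eq_iff:
  "x \<in> {1..card (edges T)} \<Longrightarrow> y \<in> {1..card (edges T)} \<Longrightarrow>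
     (labelled_perm T l \<rho> ^^ k) x = y \<longleftrightarrow> (\<rho> ^^ k) (l x) = l y"
  using labelled_perm_funpow[of x k] l_eq_iff[of "(labelled_perm T l \<rho> ^^ k) x" y] by metis

lemma labelled_perm_orbit:
  "x \<in> {1..card (edges T)} \<Longrightarrow> y \<in> {1..card (edges T)} \<Longrightarrow>
     y \<in> orbit (labelled_perm T l \<rho>) x \<longleftrightarrow> l y \<in> orbit \<rho> (l x)"
  using labelled_perm_funpow_eq_iff[of x y] by (auto simp: orbit_altdef) metis+

lemma labelled_perm_least_power:
  "x \<in> {1..card (edges T)} \<Longrightarrow> least_power (labelled_perm T l \<rho>) x = least_power \<rho> (l x)"
  by (simp add: least_power_def labelled_perm_funpow_eq_iff del: atLeastAtMost_iff)

lemma labelled_perm_cyclic_on: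
  assumes P: "P \<subseteq> edges T" "cyclic_on \<rho> P"
  shows "cyclic_on (labelled_perm T l \<rho>) {x \<in> {1..card (edges T)}. l x \<in> P}"
proof -
  obtain p where p: "p \<in> P" "P = orbit \<rho> p" using P(2) by (auto simp: cyclic_on_def)
  then have "p \<in> l ` {1..card (edges T)}" using l_bij P(1) by (auto simp: bij_betw_def)
  then obtain x where x: "x \<in> {1..card (edges T)}" "p = l x" by blast
  have "orbit (labelled_perm T l \<rho>) x \<subseteq> {1..card (edges T)}"
    by (rule permutes_orbit_subset[OF labelled_perm_permutes x(1)])
  then have "orbit (labelled_perm T l \<rho>) x = {y \<in> {1..card (edges T)}. l y \<in> P}"
    using labelled_perm_orbit[OF x(1)] p(2) x(2) by blast
  then show ?thesis using x p by (auto simp: cyclic_on_def)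
qed

end

theorem lemma5p2:
  fixes r s n d :: nat
    and T :: "('b, 'w) bicolored_map"
    and l :: "nat \<Rightarrow> 'b \<times> 'w"
  assumes "0 < r" and "0 < s" and "r \<noteq> s"
    and "n = 3 * r + 2 * s"
    and "d = gcd r s"
    and "bicolored_plane_tree T"
    and "passport T =
           (replicate_mset 3 r + replicate_mset 2 s, {#5#} + replicate_mset (n - 5) 1, n)"
    and "edge_labelling T l"
  shows "(even (n div d) \<longrightarrow>
            iso_to_semidirect_product (monodromy_group T l)
              (alt_group_power (n div d) d) (integer_mod_group (2 * d))) \<and>
         (odd (n div d) \<longrightarrow>
            iso_to_semidirect_product (monodromy_group T l)
              (alt_group_power (n div d) d) (integer_mod_group d))"
proof -
  let ?S = "{1..card (edges T)}"
  define a where "a = labelled_perm T l (rot_black T)"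
  define b where "b = labelled_perm T l (rot_white T)"
  define H where "H = generate (sym_group (card (edges T))) {a, b}"
  have card_n: "card (edges T) = n" by (rule card_edges[OF assms(6,3,7)])
  note rb = assms(8) rot_black_permutes[OF assms(6,3,7)]
  note rw = assms(8) rot_white_permutes[OF assms(6,3,7)]
  have a_S: "a permutes ?S" unfolding a_def by (rule labelled_perm_permutes[OF rb])
  have b_S: "b permutes ?S" unfolding b_def by (rule labelled_perm_permutes[OF rw])
  interpret Sym: group "sym_group (card (edges T))" by (rule sym_group_is_group)
  have ab: "{a, b} \<subseteq> carrier (sym_group (card (edges T)))"
    using a_S b_S by (simp add: sym_group_carrier)
  have H_sub: "subgroup H (sym_group (card (edges T)))"
    unfolding H_def by (rule Sym.generate_is_subgroup[OF ab])
  have H_S: "g permutes ?S" if "g \<in> H" for g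
    using subgroup.subset[OF H_sub] that sym_group_carrier by blast
  obtain P where P: "P \<subseteq> edges T" "card P = 5" "cyclic_on (rot_white T) P"
    "\<And>x. x \<notin> P \<Longrightarrow> rot_white T x = x"
    "\<And>x. x \<in> edges T \<Longrightarrow> \<exists>y\<in>P. x \<in> orbit (rot_black T) y"
    "\<And>x y. x \<in> P \<Longrightarrow> y \<in> P \<Longrightarrow> y \<in> orbit (rot_black T) x \<Longrightarrow> x = y"
    "\<And>x. x \<in> P \<Longrightarrow> least_power (rot_black T) x = r \<or> least_power (rot_black T) x = s"
    "card {x \<in> P. least_power (rot_black T) x = r} = 3"
    by (fact edge_center[OF assms(6,3,7)])
  define P' where "P' = {x \<in> ?S. l x \<in> P}"
  have l: "bij_betw l ?S (edges T)" by (rule l_bij[OF rb])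
  \<comment> \<open>Used twice for counting labels: with \<open>P\<close> itself and with its edges
    of period \<open>r\<close>.\<close>
  have l_sub: "bij_betw l {x \<in> ?S. l x \<in> Q} Q" if "Q \<subseteq> edges T" for Q
  proof (rule bij_betw_imageI)
    show "inj_on l {x \<in> ?S. l x \<in> Q}"
      using l by (auto simp only: bij_betw_def intro: inj_on_subset)
    have "l ` ?S = edges T" using l by (simp only: bij_betw_def)
    then have "\<exists>x\<in>?S. y = l x" if "y \<in> Q" for y
      using that \<open>Q \<subseteq> edges T\<close> unfolding image_iff[symmetric] by blast
    then show "l ` {x \<in> ?S. l x \<in> Q} = Q" by blast
  qed
  \<comment> \<open>The data of \<open>edge_center\<close> are pulled back along \<open>l\<close>,
    with \<open>P'\<close> the labels of the central edges.\<close>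
  interpret five_star_generated H ?S a b P' r s d
  proof
    show "finite ?S" by simp
    show "g permutes ?S" if "g \<in> H" for g using that by (rule H_S)
    show "id \<in> H" using subgroup.one_closed[OF H_sub] by (simp add: sym_group_one)
    show "g \<circ> h \<in> H" if "g \<in> H" "h \<in> H" for g h
      using subgroup.m_closed[OF H_sub that] by (simp add: sym_group_mult)
    show "inv' g \<in> H" if "g \<in> H" for g
      using subgroup.m_inv_closed[OF H_sub that] H_S[OF that] by (simp add: sym_group_carrier)
    show "a \<in> H" "b \<in> H" unfolding H_def by (auto intro: generate.incl)
    show "P' \<subseteq> ?S" by (auto simp: P'_def)
    show "card P' = 5" using bij_betw_same_card[OF l_sub[OF P(1)]] P(2) by (simp add: P'_def)
    show "cyclic_on b P'" unfolding b_def P'_def by (rule labelled_perm_cyclic_on[OF rw P(1,3)])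
    show "b y = y" if "y \<notin> P'" for y
    proof (cases "y \<in> ?S")
      case True
      then have "l (b y) = l y" "b y \<in> ?S"
        using that P(4)[of "l y"] labelled_perm_apply[OF rw True] by (auto simp: P'_def b_def)
      then show ?thesis using l_eq_iff[OF rb] True by blast
    qed (use b_S in \<open>simp add: permutes_not_in\<close>)
    show "\<exists>x\<in>P'. y \<in> orbit a x" if y: "y \<in> ?S" for y
    proof -
      have "l y \<in> edges T" using l y by (auto simp: bij_betw_def)
      then obtain z where z: "z \<in> P" "l y \<in> orbit (rot_black T) z" using P(5) by blast
      then obtain x where "x \<in> P'" "z = l x"
        using l_sub[OF P(1)] unfolding P'_def bij_betw_def by blast
      then show ?thesis
        using z labelled_perm_orbit[OF rb _ y] by (auto simp: a_def P'_def)
    qed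
    show "x = y" if xy: "x \<in> P'" "y \<in> P'" "y \<in> orbit a x" for x y
    proof -
      have S: "x \<in> ?S" "y \<in> ?S" "l x \<in> P" "l y \<in> P" using xy by (auto simp: P'_def)
      then have "l x = l y" using P(6) xy(3) labelled_perm_orbit[OF rb S(1,2)] by (simp add: a_def)
      then show ?thesis using l_eq_iff[OF rb S(1,2)] by simp
    qed
    show "least_power a x = r \<or> least_power a x = s" if "x \<in> P'" for x
      using that P(7)[of "l x"] labelled_perm_least_power[OF rb, of x] by (auto simp: P'_def a_def)
    have "{x \<in> P'. least_power a x = r} = {x \<in> ?S. l x \<in> {x \<in> P. least_power (rot_black T) x = r}}"
      using labelled_perm_least_power[OF rb] by (auto simp: P'_def a_def)
    moreover have "{x \<in> P. least_power (rot_black T) x = r} \<subseteq> edges T" using P(1) by blast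
    ultimately show "card {x \<in> P'. least_power a x = r} = 3"
      using bij_betw_same_card[OF l_sub] P(8) by metis
    show "r \<noteq> s" "0 < r" "0 < s" "d = gcd r s" by fact+
    show "card ?S = 3 * r + 2 * s" using card_n assms(4) by simp
    \<comment> \<open>A permutation group on the labels is a subgroup of the symmetric group, so it
      contains the subgroup generated by \<open>a\<close> and \<open>b\<close>.\<close>
    show "H \<subseteq> M" if M: "permutation_group M ?S" and "a \<in> M" "b \<in> M" for M
    proof -
      interpret M: permutation_group M ?S by (rule M)
      have "subgroup M (sym_group (card (edges T)))"
        using M.permutes M.id_closed M.comp_closed M.inv_closed
        by (intro Sym.subgroupI) (auto simp: sym_group_carrier sym_group_mult)
      then show ?thesis
        unfolding H_def using that by (intro Sym.generate_subgroup_incl) auto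
    qed
  qed
  have "n = d * block_size" using card_S_eq card_n by simp
  then have block_size: "n div d = block_size" using d_pos by simp
  have "iso_to_semidirect_product (monodromy_group T l) (alt_group_power block_size d)
      (integer_mod_group (if even block_size then 2 * d else d))"
  proof (rule iso_to_semidirect_product)
    show "group (monodromy_group T l)"
      unfolding monodromy_group_def by (rule Sym.group_subgroup_generated)
    show "carrier (monodromy_group T l) = H"
      using ab unfolding monodromy_group_def H_def carrier_subgroup_generated a_def b_def
      by (simp add: Int_absorb1)
  qed (simp_all add: monodromy_group_def sym_group_mult sym_group_one)
  then show ?thesis unfolding block_size by auto
qed

end
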